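(* Suppose that $\sum_{n=0}^\infty a_n^{-1}<\infty$, that $\beta_n\to\beta_\infty\in\mathbb R$ as $n\to\infty$ with $|\beta_\infty|>1$, that $\sum_n |k_n-1|<\infty$, and that $\sum_n|\beta_{n+1}-\beta_n|<\infty$. Then the relation $$P_n(z)=-\varkappa_\infty\,\Omega(z)\,\frac{(\operatorname{sgn}\beta_\infty)^{n+1}}{2\sqrt{\beta_\infty^2-1}}\,\frac{e^{\varphi_n}}{\sqrt{a_n}}\,(1+o(1)),\qquad n\to\infty,$$ is true for all $z\in\mathbb C$, with convergence uniform on compact subsets of $z\in\mathbb C$. Moreover, if $\Omega(z)=0$, then $$\lim_{n\to\infty}\sqrt{a_n}\,e^{\varphi_n}(\operatorname{sgn}\beta_\infty)^nP_n(z)=\{P(z),g(z)\}\neq0.$$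
   Context: $\mathbb Z_+=\{0,1,2,\dots\}$. The coefficients satisfy $a_n>0$, $b_n\in\mathbb R$ for $n\in\mathbb Z_+$, and by convention $a_{-1}=1/2$. Notation: $$\beta_n=-\frac{b_n}{2\sqrt{a_{n-1}a_n}},\qquad k_n=\frac{a_n}{\sqrt{a_{n-1}a_{n+1}}},\qquad \varkappa_n=\sqrt{\frac{a_{n+1}}{a_n}},\qquad \varkappa_\infty=\lim_{n\to\infty}\varkappa_n$$ (this limit exists and is finite under the hypotheses). The phase is $\varphi_n=\sum_m\operatorname{arccosh}|\beta_m|$, the sum being over those $m\in\{0,\dots,n-1\}$ with $|\beta_m|\ge1$. The Jacobi equation is $a_{n-1}F_{n-1}+b_nF_n+a_nF_{n+1}=zF_n$, $n\in\mathbb Z_+$, for sequences $F=(F_n)_{n\ge-1}$. The orthogonal polynomials $P(z)=(P_n(z))_{n\ge-1}$ are its solution with $P_{-1}(z)=0$, $P_0(z)=1$. The Wronskian of two solutions $F,G$ is $\{F,G\}=a_n(F_nG_{n+1}-F_{n+1}G_n)$, which does not depend on $n$. The Jost solution $f(z)=(f_n(z))_{n\ge-1}$ is the unique solution of the Jacobi equation with $f_n(z)=a_n^{-1/2}(\operatorname{sgn}\beta_\infty)^ne^{-\varphi_n}(1+o(1))$ as $n\to\infty$. The Jost function is $\Omega(z)=\{P(z),f(z)\}=-\tfrac12f_{-1}(z)$. The solution $g(z)$ is defined as follows: choose $n_0=n_0(z)\ge 1$ such that $f_n(z)\ne0$ for all $n\ge n_0-1$, and set $$g_n(z)=f_n(z)\sum_{m=n_0}^n\big(a_{m-1}f_{m-1}(z)f_m(z)\big)^{-1},\qquad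 n\ge n_0;$$ it satisfies the Jacobi equation for large $n$ (and extends uniquely to a solution for all $n\ge -1$), and $\{f(z),g(z)\}=1$.
   Formalization: Where Ω(z)=0 the factor (1+o(1)) would force P_n(z)=0 for large n, which is impossible; so the relation is stated with −ϰ_∞Ω(z)+o(1), uniformly on all compact sets, and with −ϰ_∞Ω(z)(1+o(1)) uniformly on compact sets where Ω has no zeros. *)

theory Defs
  imports "HOL-Analysis.Analysis" "HOL-Library.Landau_Symbols"
begin

text \<open>
  The coefficients are \<open>a, b :: nat \<Rightarrow> real\<close>. A sequence \<open>(F\<^sub>n)\<close> with \<open>n \<ge> -1\<close> is represented by
  \<open>F :: nat \<Rightarrow> complex\<close> with the index shifted by one: \<open>F 0\<close> is the term with index \<open>-1\<close>, and
  \<open>F (n + 1)\<close> is the term with index \<open>n\<close>.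
\<close>

text \<open>The number \<open>prev_coeff a n\<close> is the coefficient with index \<open>n - 1\<close>, the one with index \<open>-1\<close> being \<open>1/2\<close>.\<close>

definition prev_coeff :: "(nat \<Rightarrow> real) \<Rightarrow> nat \<Rightarrow> real" where
  "prev_coeff a n = (if n = 0 then 1/2 else a (n - 1))"

definition beta :: "(nat \<Rightarrow> real) \<Rightarrow> (nat \<Rightarrow> real) \<Rightarrow> nat \<Rightarrow> real" where
  "beta a b n = - b n / (2 * sqrt (prev_coeff a n * a n))"

definition kcoeff :: "(nat \<Rightarrow> real) \<Rightarrow> nat \<Rightarrow> real" where
  "kcoeff a n = a n / sqrt (prev_coeff a n * a (n + 1))"

definition varkappa :: "(nat \<Rightarrow> real) \<Rightarrow> nat \<Rightarrow> real" where
  "varkappa a n = sqrt (a (n + 1) / a n)"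

definition varkappa_inf :: "(nat \<Rightarrow> real) \<Rightarrow> real" where
  "varkappa_inf a = lim (varkappa a)"

definition phase :: "(nat \<Rightarrow> real) \<Rightarrow> (nat \<Rightarrow> real) \<Rightarrow> nat \<Rightarrow> real" where
  "phase a b n = (\<Sum>m \<in> {m. m < n \<and> \<bar>beta a b m\<bar> \<ge> 1}. arcosh \<bar>beta a b m\<bar>)"

definition jacobi_solution ::
  "(nat \<Rightarrow> real) \<Rightarrow> (nat \<Rightarrow> real) \<Rightarrow> complex \<Rightarrow> (nat \<Rightarrow> complex) \<Rightarrow> bool" where
  "jacobi_solution a b z F \<longleftrightarrow>
     (\<forall>n. of_real (prev_coeff a n) * F n + of_real (b n) * F (n + 1) + of_real (a n) * F (n + 2)
          = z * F (n + 1))"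

fun ortho_poly :: "(nat \<Rightarrow> real) \<Rightarrow> (nat \<Rightarrow> real) \<Rightarrow> complex \<Rightarrow> nat \<Rightarrow> complex" where
  "ortho_poly a b z 0 = 0"
| "ortho_poly a b z (Suc 0) = 1"
| "ortho_poly a b z (Suc (Suc n)) =
     ((z - of_real (b n)) * ortho_poly a b z (Suc n) - of_real (prev_coeff a n) * ortho_poly a b z n)
       / of_real (a n)"

text \<open>
  The Wronskian expression at index \<open>n - 1\<close>. On solutions of the same Jacobi equation it does not
  depend on \<open>n\<close> (lemma \<open>wronskian_at_const\<close>), and \<open>wronskian\<close> evaluates it at index \<open>-1\<close>.
\<close>

definition wronskian_at ::
  "(nat \<Rightarrow> real) \<Rightarrow> (nat \<Rightarrow> complex) \<Rightarrow> (nat \<Rightarrow> complex) \<Rightarrow> nat \<Rightarrow> complex" where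
  "wronskian_at a F G n = of_real (prev_coeff a n) * (F n * G (n + 1) - F (n + 1) * G n)"

definition wronskian :: "(nat \<Rightarrow> real) \<Rightarrow> (nat \<Rightarrow> complex) \<Rightarrow> (nat \<Rightarrow> complex) \<Rightarrow> complex" where
  "wronskian a F G = wronskian_at a F G 0"

text \<open>The parameter \<open>binf\<close> stands for the limit of the sequence \<open>beta a b\<close>.\<close>

definition is_jost_solution ::
  "(nat \<Rightarrow> real) \<Rightarrow> (nat \<Rightarrow> real) \<Rightarrow> real \<Rightarrow> complex \<Rightarrow> (nat \<Rightarrow> complex) \<Rightarrow> bool" where
  "is_jost_solution a b binf z F \<longleftrightarrow>
     jacobi_solution a b z F \<and>
     (\<lambda>n. F (n + 1)) \<sim>[sequentially]
       (\<lambda>n. of_real (1 / sqrt (a n) * sgn binf ^ n * exp (- phase a b n)))"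

definition jost_solution ::
  "(nat \<Rightarrow> real) \<Rightarrow> (nat \<Rightarrow> real) \<Rightarrow> real \<Rightarrow> complex \<Rightarrow> nat \<Rightarrow> complex" where
  "jost_solution a b binf z = (THE F. is_jost_solution a b binf z F)"

definition jost_function ::
  "(nat \<Rightarrow> real) \<Rightarrow> (nat \<Rightarrow> real) \<Rightarrow> real \<Rightarrow> complex \<Rightarrow> complex" where
  "jost_function a b binf z = wronskian a (ortho_poly a b z) (jost_solution a b binf z)"

definition admissible_start ::
  "(nat \<Rightarrow> real) \<Rightarrow> (nat \<Rightarrow> real) \<Rightarrow> real \<Rightarrow> complex \<Rightarrow> nat \<Rightarrow> bool" where
  "admissible_start a b binf z n0 \<longleftrightarrow>
     n0 \<ge> 1 \<and> (\<forall>n \<ge> n0 - 1. jost_solution a b binf z (n + 1) \<noteq> 0)"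

text \<open>
  In the shifted indexing \<open>f (n + 1)\<close>, \<open>f (m + 1)\<close> and \<open>f m\<close> are the terms of the Jost solution with
  index \<open>n\<close>, \<open>m\<close> and \<open>m - 1\<close>. Prescribing the terms with index at least \<open>n0\<close> determines the solution.
\<close>

definition second_solution ::
  "(nat \<Rightarrow> real) \<Rightarrow> (nat \<Rightarrow> real) \<Rightarrow> real \<Rightarrow> complex \<Rightarrow> nat \<Rightarrow> nat \<Rightarrow> complex" where
  "second_solution a b binf z n0 =
     (let f = jost_solution a b binf z in
      THE G. jacobi_solution a b z G \<and>
        (\<forall>n \<ge> n0. G (n + 1) =
           f (n + 1) * (\<Sum>m = n0..n. inverse (of_real (prev_coeff a m) * f m * f (m + 1)))))"

lemma ortho_poly_jacobi_solution:
  assumes "\<And>n. a n > 0"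
  shows "jacobi_solution a b z (ortho_poly a b z)"
proof -
  have "a n \<noteq> 0" for n using assms[of n] by simp
  then show ?thesis
    by (simp add: jacobi_solution_def field_simps)
qed

lemma wronskian_at_const:
  assumes "jacobi_solution a b z F" "jacobi_solution a b z G"
  shows "wronskian_at a F G n = wronskian a F G"
proof (induction n)
  case 0
  then show ?case by (simp add: wronskian_def)
next
  case (Suc n)
  let ?p = "of_real (prev_coeff a n) :: complex"
  have F: "of_real (a n) * F (n + 2) = (z - of_real (b n)) * F (n + 1) - ?p * F n"
    and G: "of_real (a n) * G (n + 2) = (z - of_real (b n)) * G (n + 1) - ?p * G n"
    using assms by (auto simp: jacobi_solution_def algebra_simps)
  have "wronskian_at a F G (Suc n)
      = F (n + 1) * (of_real (a n) * G (n + 2)) - (of_real (a n) * F (n + 2)) * G (n + 1)"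
    by (simp add: wronskian_at_def prev_coeff_def algebra_simps)
  also have "\<dots> = wronskian_at a F G n"
    unfolding F G by (simp add: wronskian_at_def algebra_simps)
  finally show ?case using Suc by simp
qed

lemma jost_function_eq: "jost_function a b binf z = - jost_solution a b binf z 0 / 2"
  by (simp add: jost_function_def wronskian_def wronskian_at_def prev_coeff_def)

end

theory Submission
  imports Defs
begin

text \<open>
  Let \<open>s = sgn \<beta>\<^sub>\<infinity>\<close> and \<open>\<theta>\<^sub>n = exp (- arcosh |\<beta>\<^sub>n|)\<close>. For a solution \<open>F\<close> put
  \<open>F\<^sub>n = s^n a\<^sub>n^(-1/2) exp \<phi>\<^sub>n v\<^sub>n\<close>. The Jacobi equation becomes
  \<open>v\<^sub>n\<^sub>+\<^sub>2 - v\<^sub>n\<^sub>+\<^sub>1 = A\<^sub>n (v\<^sub>n\<^sub>+\<^sub>1 - v\<^sub>n) + R\<^sub>n v\<^sub>n\<^sub>+\<^sub>1\<close>, where \<open>A\<^sub>n\<close> tends to \<open>\<theta>\<^sub>\<infinity>^2 < 1\<close> and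
  \<open>R\<^sub>n\<close> is summable, uniformly for \<open>z\<close> in a compact set. Hence \<open>v\<^sub>n\<close> converges, uniformly on compact
  sets. Some solution \<open>y\<close> has a nonzero limit, and reduction of order along \<open>y\<close> yields the Jost
  solution for each single \<open>z\<close>. Evaluating the Wronskian of \<open>P\<close> and \<open>f\<close> at infinity identifies the limit
  of \<open>v\<^sub>n\<close> for \<open>F = P\<close> as a multiple of \<open>\<Omega>\<close>, so that no uniformity of the asymptotics of \<open>f\<close> in \<open>z\<close> is
  needed; \<open>\<Omega>\<close> is continuous as a locally uniform limit of polynomials. If \<open>\<Omega>(z) = 0\<close>, then \<open>P\<close> is a
  multiple of \<open>f\<close>.
\<close>

subsection \<open>Perturbed linear recurrences\<close>

text \<open>Summing the inequality bounds each partial sum by \<open>d 0 + suminf e\<close> plus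
  \<open>\<rho>\<close> times the preceding one. The number \<open>?C\<close> is the fixed point of
  this affine map, so no partial sum exceeds it.\<close>

lemma summable_perturbed_contraction:
  fixes d e :: "nat \<Rightarrow> real"
  assumes rho: "0 \<le> \<rho>" "\<rho> < 1"
    and d: "\<And>n. 0 \<le> d n" "\<And>n. d (Suc n) \<le> \<rho> * d n + e n"
    and e: "\<And>n. 0 \<le> e n" "summable e"
  shows "summable d"
proof (rule summableI_nonneg_bounded)
  fix m
  let ?C = "(d 0 + suminf e) / (1 - \<rho>)"
  show "(\<Sum>i<m. d i) \<le> ?C"
  proof (induction m)
    case 0
    then show ?case using rho d(1)[of 0] suminf_nonneg[OF e(2,1)] by simp
  next
    case (Suc m)
    have "(\<Sum>i<Suc m. d i) = d 0 + (\<Sum>i<m. d (Suc i))"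
      by (rule sum.lessThan_Suc_shift)
    also have "\<dots> \<le> d 0 + (\<Sum>i<m. \<rho> * d i + e i)"
      by (intro add_left_mono sum_mono d)
    also have "\<dots> = d 0 + \<rho> * (\<Sum>i<m. d i) + (\<Sum>i<m. e i)"
      by (simp add: sum.distrib sum_distrib_left)
    also have "\<dots> \<le> d 0 + \<rho> * ?C + suminf e"
      by (intro add_mono mult_left_mono Suc sum_le_suminf order_refl rho e) auto
    also have "\<dots> = ?C"
      using rho by (simp add: field_simps)
    finally show ?case .
  qed
qed (rule d)

text \<open>The quantity \<open>|v (n + 1)| + \<rho> / (1 - \<rho>) * |v (n + 1) - v n|\<close> grows by at most the factor
  \<open>1 + e n / (1 - \<rho>)\<close> in each step.\<close>

lemma perturbed_recurrence_bounds:
  fixes v :: "nat \<Rightarrow> 'a :: real_normed_vector" and e :: "nat \<Rightarrow> real"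
  assumes rho: "0 \<le> \<rho>" "\<rho> < 1"
    and e: "\<And>n. 0 \<le> e n" "\<And>n. (\<Sum>i<n. e i) \<le> (1 - \<rho>) / 4"
    and v: "\<And>n. norm (v (n + 2) - v (n + 1)) \<le> \<rho> * norm (v (n + 1) - v n) + e n * norm (v (n + 1))"
  defines "B \<equiv> norm (v 1) + \<rho> / (1 - \<rho>) * norm (v 1 - v 0)"
  shows "norm (v (n + 1)) \<le> 2 * B"
    and "norm (v 1) - \<rho> / (1 - \<rho>) * norm (v 1 - v 0) - B / 2 \<le> norm (v (n + 1))"
proof -
  define C where "C = \<rho> / (1 - \<rho>)"
  have C: "C \<ge> 0" "1 + C = 1 / (1 - \<rho>)" "(1 + C) * \<rho> = C"
    using rho by (auto simp: C_def field_simps)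
  have B: "B \<ge> 0" using C by (simp add: B_def C_def[symmetric])
  \<comment> \<open>As \<open>1 + C = 1 / (1 - \<rho>)\<close>, the bound
    \<open>(1 - \<rho>) / 4\<close> on the sums keeps the total accumulated error at most
    \<open>B / 2\<close>.\<close>
  have small: "2 * B * (1 + C) * (\<Sum>i<n. e i) \<le> B / 2" for n
  proof -
    have "2 * B * (1 + C) * (\<Sum>i<n. e i) \<le> 2 * B * (1 + C) * ((1 - \<rho>) / 4)"
      using B C(1) by (intro mult_left_mono e) simp
    also have "\<dots> = B / 2" using rho by (simp add: C(2))
    finally show ?thesis .
  qed
  define d where "d n = norm (v (n + 1) - v n)" for n
  have dd: "(1 + C) * d (n + 1) \<le> C * d n + (1 + C) * e n * norm (v (n + 1))" for n
  proof -
    have "(1 + C) * d (n + 1) \<le> (1 + C) * (\<rho> * d n + e n * norm (v (n + 1)))"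
      using C(1) v[of n] by (intro mult_left_mono) (simp_all add: d_def)
    also have "\<dots> = ((1 + C) * \<rho>) * d n + (1 + C) * e n * norm (v (n + 1))"
      by (simp add: algebra_simps)
    finally show ?thesis by (simp only: C(3))
  qed
  have vd: "\<bar>norm (v (n + 2)) - norm (v (n + 1))\<bar> \<le> d (n + 1)" for n
    using norm_triangle_ineq3[of "v (n + 2)" "v (n + 1)"] by (simp add: d_def)
  \<comment> \<open>Both bounds go through one induction: the upper one yields
    \<open>norm (v (n + 1)) \<le> 2 * B\<close>, which controls the error that the next step adds in
    either of them.\<close>
  have main: "norm (v (n + 1)) + C * d n \<le> B + 2 * B * (1 + C) * (\<Sum>i<n. e i) \<and>
    norm (v (n + 1)) - C * d n \<ge> norm (v 1) - C * d 0 - 2 * B * (1 + C) * (\<Sum>i<n. e i)" for n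
  proof (induction n)
    case 0
    then show ?case by (simp add: B_def C_def d_def)
  next
    case (Suc n)
    have "0 \<le> C * d n" using C by (simp add: d_def)
    then have "norm (v (n + 1)) \<le> 2 * B" using Suc small[of n] B by linarith
    then have "(1 + C) * e n * norm (v (n + 1)) \<le> (1 + C) * e n * (2 * B)"
      using C(1) e(1) by (intro mult_left_mono) simp_all
    then have "(1 + C) * d (n + 1) \<le> C * d n + 2 * B * (1 + C) * e n"
      using dd[of n] by (simp add: algebra_simps)
    then have "d (n + 1) + C * d (n + 1) \<le> C * d n + 2 * B * (1 + C) * e n"
      by (simp add: algebra_simps)
    moreover have "2 * B * (1 + C) * (\<Sum>i<Suc n. e i)
        = 2 * B * (1 + C) * (\<Sum>i<n. e i) + 2 * B * (1 + C) * e n"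
      by (simp add: algebra_simps)
    ultimately show ?case using Suc vd[of n] by auto
  qed
  have "0 \<le> C * d n" using C by (simp add: d_def)
  then show "norm (v (n + 1)) \<le> 2 * B"
    and "norm (v 1) - \<rho> / (1 - \<rho>) * norm (v 1 - v 0) - B / 2 \<le> norm (v (n + 1))"
    using main[of n] small[of n] B by (simp_all add: C_def[symmetric] d_def)
qed

lemma small_tail_sums:
  fixes e :: "nat \<Rightarrow> real"
  assumes "summable e" "\<And>n. 0 \<le> e n" "0 < c"
  obtains N where "\<And>n. (\<Sum>i<n. e (i + N)) \<le> c"
proof -
  obtain N where "norm (\<Sum>i. e (i + N)) < c"
    using suminf_exist_split[OF assms(3,1)] by blast
  moreover have "(\<Sum>i<n. e (i + N)) \<le> (\<Sum>i. e (i + N))" for n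
    using assms by (intro sum_le_suminf summable_ignore_initial_segment) auto
  ultimately have "(\<Sum>i<n. e (i + N)) \<le> c" for n
    using abs_ge_self[of "\<Sum>i. e (i + N)"] order_trans[of "\<Sum>i<n. e (i + N)" "\<Sum>i. e (i + N)" c]
    by (simp only: real_norm_def)
  then show ?thesis by (rule that)
qed

text \<open>Beyond some index the bounds above make \<open>v\<close> bounded uniformly in
  \<open>z\<close>, so the error term is at most a summable sequence free of \<open>z\<close>. The
  increments then have a summable majorant \<open>D\<close>, and the Weierstrass test applies to
  their telescoping sum.\<close>

lemma perturbed_recurrence_uniform_limit:
  fixes v :: "nat \<Rightarrow> 'b \<Rightarrow> 'a :: banach" and e :: "nat \<Rightarrow> real"
  assumes rho: "0 \<le> \<rho>" "\<rho> < 1"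
    and e: "\<And>n. 0 \<le> e n" "summable e"
    and bdd: "\<And>n. \<exists>M. \<forall>z\<in>K. norm (v n z) \<le> M"
    and v: "\<And>n z. \<lbrakk>n \<ge> N0; z \<in> K\<rbrakk> \<Longrightarrow>
       norm (v (n + 2) z - v (n + 1) z)
         \<le> \<rho> * norm (v (n + 1) z - v n z) + e n * norm (v (n + 1) z)"
  obtains V where "uniform_limit K v V sequentially"
proof -
  have "summable (\<lambda>n. e (n + N0))"
    using e by (rule_tac summable_ignore_initial_segment)
  then obtain N1 where N1: "\<And>n. (\<Sum>i<n. e (i + N1 + N0)) \<le> (1 - \<rho>) / 4"
    using e(1) rho(2) small_tail_sums[of "\<lambda>n. e (n + N0)" "(1 - \<rho>) / 4"] by auto
  define N where "N = N1 + N0"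
  obtain M0 where M0: "\<And>z. z \<in> K \<Longrightarrow> norm (v N z) \<le> M0" using bdd[of N] by blast
  obtain M1 where M1: "\<And>z. z \<in> K \<Longrightarrow> norm (v (Suc N) z) \<le> M1" using bdd[of "Suc N"] by blast
  define C where "C = \<rho> / (1 - \<rho>)"
  have C: "C \<ge> 0" using rho by (simp add: C_def)
  \<comment> \<open>The \<open>max 0\<close> covers an empty \<open>K\<close>, for which
    \<open>M0\<close> and \<open>M1\<close> may be negative.\<close>
  define B where "B = max 0 (M1 + C * (M1 + M0))"
  have d0: "norm (v (Suc N) z - v N z) \<le> M1 + M0" if "z \<in> K" for z
    using M0[OF that] M1[OF that] norm_triangle_ineq4[of "v (Suc N) z" "v N z"] by linarith
  have bound: "norm (v (n + 1 + N) z) \<le> 2 * B" if z: "z \<in> K" for n z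
  proof -
    have "norm (v (n + 1 + N) z) \<le> 2 * (norm (v (1 + N) z)
        + \<rho> / (1 - \<rho>) * norm (v (1 + N) z - v (0 + N) z))"
    proof (rule perturbed_recurrence_bounds(1)[OF rho, where e = "\<lambda>n. e (n + N)" and v = "\<lambda>n. v (n + N) z"])
      show "(\<Sum>i<n. e (i + N)) \<le> (1 - \<rho>) / 4" for n
        using N1[of n] by (simp add: N_def add_ac)
      show "norm (v (n + 2 + N) z - v (n + 1 + N) z)
          \<le> \<rho> * norm (v (n + 1 + N) z - v (n + N) z) + e (n + N) * norm (v (n + 1 + N) z)" for n
        using v[of "n + N", OF _ z] by (simp add: N_def add_ac)
    qed (rule e)
    also have "\<dots> \<le> 2 * (M1 + C * (M1 + M0))"
      unfolding C_def[symmetric] using mult_left_mono[OF d0[OF z] C] M1[OF z] by simp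
    also have "\<dots> \<le> 2 * B" unfolding B_def by (intro mult_left_mono max.cobounded2) simp
    finally show ?thesis .
  qed
  \<comment> \<open>Majorant of the increments: the recurrence inequality turned into an equation,
    with the bound \<open>2 * B\<close> in place of the values of \<open>v\<close>.\<close>
  define D where "D = rec_nat (max 0 (M1 + M0)) (\<lambda>n x. \<rho> * x + e (n + N) * (2 * B))"
  have D_simps: "D 0 = max 0 (M1 + M0)" "D (Suc n) = \<rho> * D n + e (n + N) * (2 * B)" for n
    by (simp_all add: D_def)
  have B: "B \<ge> 0" by (simp add: B_def)
  have D_nonneg: "D n \<ge> 0" for n
    by (induction n) (use rho e B in \<open>simp_all add: D_simps\<close>)
  have "summable D"
    by (rule summable_perturbed_contraction[OF rho, where e = "\<lambda>n. e (n + N) * (2 * B)"])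
       (use D_nonneg D_simps e B in \<open>auto intro!: summable_mult2 summable_ignore_initial_segment\<close>)
  have dD: "norm (v (Suc n + N) z - v (n + N) z) \<le> D n" if z: "z \<in> K" for n z
  proof (induction n)
    case 0
    then show ?case using d0[OF z] by (simp add: D_simps)
  next
    case (Suc n)
    have "norm (v (Suc (Suc n) + N) z - v (Suc n + N) z)
        \<le> \<rho> * norm (v (Suc n + N) z - v (n + N) z) + e (n + N) * norm (v (n + 1 + N) z)"
      using v[of "n + N", OF _ z] by (simp add: N_def add_ac)
    also have "\<dots> \<le> \<rho> * D n + e (n + N) * (2 * B)"
      using rho e bound[OF z, of n] Suc by (intro add_mono mult_left_mono) auto
    finally show ?case by (simp add: D_simps)
  qed
  have "uniform_limit K (\<lambda>n z. \<Sum>i<n. v (Suc i + N) z - v (i + N) z)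
      (\<lambda>z. \<Sum>i. v (Suc i + N) z - v (i + N) z) sequentially"
    by (rule Weierstrass_m_test[OF _ \<open>summable D\<close>]) (rule dD)
  then have "uniform_limit K (\<lambda>n z. v N z + (\<Sum>i<n. v (Suc i + N) z - v (i + N) z))
      (\<lambda>z. v N z + (\<Sum>i. v (Suc i + N) z - v (i + N) z)) sequentially"
    by (intro uniform_limit_intros)
  moreover have "v N z + (\<Sum>i<n. v (Suc i + N) z - v (i + N) z) = v (n + N) z" for n z
    by (induction n) (simp_all add: algebra_simps)
  ultimately have "uniform_limit K (\<lambda>n. v (n + N))
      (\<lambda>z. v N z + (\<Sum>i. v (Suc i + N) z - v (i + N) z)) sequentially"
    by simp
  then have "uniform_limit K v (\<lambda>z. v N z + (\<Sum>i. v (Suc i + N) z - v (i + N) z)) sequentially"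
    unfolding uniform_limit_iff eventually_sequentially_seg[where P = "\<lambda>n. \<forall>z\<in>K. dist (v n z) (_ z) < _"] .
  then show ?thesis by (rule that)
qed

text \<open>With \<open>S n\<close> the tail sum, \<open>(1 - q) * S n - c n\<close> is the sum over
  \<open>m \<ge> n\<close> of \<open>c (m + 1) - q * c m\<close>. These terms are small relative to
  \<open>c m\<close>, and comparison with a geometric series bounds the tail sum of
  \<open>norm (c m)\<close> by a multiple of \<open>norm (c n)\<close>.\<close>

lemma geometric_tail_asymptotics:
  fixes c :: "nat \<Rightarrow> 'a :: {real_normed_field, banach}"
  assumes q: "norm q < 1" and nz: "\<And>n. n \<ge> N \<Longrightarrow> c n \<noteq> 0"
    and ratio: "(\<lambda>n. c (Suc n) / c n) \<longlonglongrightarrow> q"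
  shows "summable c" and "(\<lambda>n. (\<Sum>m. c (m + n)) / c n) \<longlonglongrightarrow> 1 / (1 - q)"
proof -
  obtain \<rho> where \<rho>: "norm q < \<rho>" "\<rho> < 1" using q dense by blast
  then have \<rho>0: "0 \<le> \<rho>" using norm_ge_zero[of q] by linarith
  have "(\<lambda>n. norm (c (Suc n) / c n)) \<longlonglongrightarrow> norm q" by (rule tendsto_norm[OF ratio])
  then have "eventually (\<lambda>n. norm (c (Suc n) / c n) < \<rho> \<and> n \<ge> N) sequentially"
    using \<rho>(1) by (auto intro!: eventually_conj order_tendstoD eventually_ge_at_top)
  then obtain N1 where N1: "\<And>n. n \<ge> N1 \<Longrightarrow> norm (c (Suc n) / c n) < \<rho> \<and> n \<ge> N"
    unfolding eventually_sequentially by blast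
  have step: "norm (c (Suc n)) \<le> \<rho> * norm (c n)" if "n \<ge> N1" for n
    using N1[OF that] nz[of n] by (auto simp: norm_divide field_simps)
  have geo: "norm (c (m + n)) \<le> norm (c n) * \<rho> ^ m" if "n \<ge> N1" for m n
  proof (induction m)
    case (Suc m)
    have "norm (c (Suc m + n)) \<le> \<rho> * norm (c (m + n))" using step[of "m + n"] that by simp
    also have "\<dots> \<le> \<rho> * (norm (c n) * \<rho> ^ m)" by (rule mult_left_mono[OF Suc \<rho>0])
    finally show ?case by (simp add: mult_ac)
  qed simp
  have sg: "summable (\<lambda>m. norm (c n) * \<rho> ^ m)" for n
    using \<rho> \<rho>0 by (intro summable_mult summable_geometric) auto
  have sn: "summable (\<lambda>m. norm (c (m + n)))" if "n \<ge> N1" for n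
    by (rule summable_comparison_test'[OF sg[of n], of 0]) (use geo that in auto)
  have "summable (\<lambda>m. c (m + N1))" by (rule summable_norm_cancel[OF sn]) simp
  then show sc: "summable c" by (simp only: summable_iff_shift)
  have sc': "summable (\<lambda>m. c (m + n))" for n by (rule summable_ignore_initial_segment[OF sc])
  have sum_le: "(\<Sum>m. norm (c (m + n))) \<le> norm (c n) / (1 - \<rho>)" if "n \<ge> N1" for n
  proof -
    have "(\<Sum>m. norm (c (m + n))) \<le> (\<Sum>m. norm (c n) * \<rho> ^ m)"
      by (rule suminf_le[OF _ sn[OF that] sg]) (rule geo[OF that])
    also have "\<dots> = norm (c n) / (1 - \<rho>)"
      using \<rho> \<rho>0 by (simp add: suminf_mult summable_geometric suminf_geometric)
    finally show ?thesis .
  qed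
  define S where "S n = (\<Sum>m. c (m + n))" for n
  have S: "S n = c n + S (Suc n)" for n
    using suminf_split_initial_segment[OF sc', of n 1] by (simp add: S_def)
  have "(\<lambda>n. ((1 - q) * S n - c n) / c n) \<longlonglongrightarrow> 0"
  proof (rule LIMSEQ_I)
    fix r :: real assume r: "0 < r"
    \<comment> \<open>Chosen so that \<open>\<delta> / (1 - \<rho>) = r / 2\<close>, which leaves
      room for a strict inequality.\<close>
    define \<delta> where "\<delta> = r * (1 - \<rho>) / 2"
    have \<delta>: "\<delta> > 0" using r \<rho> by (simp add: \<delta>_def)
    obtain N2 where N2: "\<And>n. n \<ge> N2 \<Longrightarrow> norm (c (Suc n) / c n - q) < \<delta>"
      using LIMSEQ_D[OF ratio \<delta>] by blast
    have "norm (((1 - q) * S n - c n) / c n - 0) < r" if n: "n \<ge> max N1 N2" for n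
    proof -
      have n1: "n \<ge> N1" and c0: "c n \<noteq> 0" using n N1[of n] nz[of n] by auto
      have le: "norm (c (Suc m + n) - q * c (m + n)) \<le> \<delta> * norm (c (m + n))" for m
      proof -
        have c0: "c (m + n) \<noteq> 0" using n N1[of "m + n"] nz[of "m + n"] by auto
        have "norm (c (Suc m + n) - q * c (m + n)) = norm (c (Suc m + n) / c (m + n) - q) * norm (c (m + n))"
          using c0 by (simp add: norm_mult[symmetric] left_diff_distrib)
        also have "\<dots> \<le> \<delta> * norm (c (m + n))"
          using N2[of "m + n"] n by (intro mult_right_mono) auto
        finally show ?thesis .
      qed
      have sS: "summable (\<lambda>m. c (Suc m + n))" using sc'[of "Suc n"] by simp
      have "(1 - q) * S n - c n = S (Suc n) - q * S n" by (simp add: S[of n] algebra_simps)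
      also have "\<dots> = (\<Sum>m. c (Suc m + n) - q * c (m + n))"
        using suminf_diff[OF sS summable_mult[OF sc', of q n]] by (simp only: S_def suminf_mult[OF sc'] add_Suc_right add_Suc)
      also have "norm \<dots> \<le> (\<Sum>m. \<delta> * norm (c (m + n)))"
      proof (rule norm_suminf_le[OF le])
        show "summable (\<lambda>m. \<delta> * norm (c (m + n)))" by (rule summable_mult[OF sn[OF n1]])
      qed
      also have "\<dots> = \<delta> * (\<Sum>m. norm (c (m + n)))" by (rule suminf_mult[OF sn[OF n1]])
      also have "\<dots> \<le> \<delta> * (norm (c n) / (1 - \<rho>))"
        using \<delta> by (intro mult_left_mono sum_le n1) auto
      also have "\<dots> = r / 2 * norm (c n)" using \<rho> by (simp add: \<delta>_def field_simps)
      also have "\<dots> < r * norm (c n)" using c0 r by simp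
      finally show ?thesis using c0 by (simp add: norm_divide divide_less_eq)
    qed
    then show "\<exists>no. \<forall>n\<ge>no. norm (((1 - q) * S n - c n) / c n - 0) < r" by blast
  qed
  then have "(\<lambda>n. (1 + ((1 - q) * S n - c n) / c n) / (1 - q)) \<longlonglongrightarrow> (1 + 0) / (1 - q)"
    using q by (intro tendsto_intros) auto
  moreover have "eventually (\<lambda>n. (1 + ((1 - q) * S n - c n) / c n) / (1 - q) = S n / c n) sequentially"
    using eventually_ge_at_top[of N]
  proof eventually_elim
    case (elim n)
    have "q \<noteq> 1" using q by auto
    then show ?case using nz[OF elim] by (simp add: field_simps)
  qed
  ultimately show "(\<lambda>n. S n / c n) \<longlonglongrightarrow> 1 / (1 - q)"
    by (auto elim: Lim_transform_eventually)
qed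

subsection \<open>Solutions of the Jacobi equation\<close>

lemma prev_coeff_pos:
  assumes "\<And>n. a n > 0"
  shows "prev_coeff a n > 0"
  using assms by (simp add: prev_coeff_def)

lemma prev_coeff_Suc [simp]: "prev_coeff a (Suc n) = a n"
  by (simp add: prev_coeff_def)

text \<open>Both outer coefficients are nonzero, so the recurrence runs forwards and backwards, and
  agreement at two consecutive positions passes to every other such pair.\<close>

lemma jacobi_solution_unique:
  assumes a: "\<And>n. a n > 0"
    and F: "jacobi_solution a b z F" and G: "jacobi_solution a b z G"
    and eq: "F n = G n" "F (Suc n) = G (Suc n)"
  shows "F = G"
proof -
  have step: "(F m = G m \<and> F (Suc m) = G (Suc m)) \<longleftrightarrow> (F (Suc m) = G (Suc m) \<and> F (Suc (Suc m)) = G (Suc (Suc m)))" for m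
  proof -
    have "of_real (prev_coeff a m) * (F m - G m)
        = (z - of_real (b m)) * (F (Suc m) - G (Suc m)) - of_real (a m) * (F (Suc (Suc m)) - G (Suc (Suc m)))"
      using F[unfolded jacobi_solution_def, rule_format, of m] G[unfolded jacobi_solution_def, rule_format, of m]
      by (simp add: algebra_simps)
    then show ?thesis using a[of m] prev_coeff_pos[of a m, OF a] by auto
  qed
  have "F m = G m \<and> F (Suc m) = G (Suc m) \<longleftrightarrow> F 0 = G 0 \<and> F (Suc 0) = G (Suc 0)" for m
    by (induction m) (use step in blast)+
  then show ?thesis using eq by blast
qed

text \<open>Forward recursion settles data at position 0; data further out are moved back one
  position at a time.\<close>

lemma jacobi_solution_exists:
  assumes a: "\<And>n. a n > 0"
  obtains F where "jacobi_solution a b z F" "F n = p" "F (Suc n) = q"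
proof -
  have "\<exists>F. jacobi_solution a b z F \<and> F n = p \<and> F (Suc n) = q"
  proof (induction n arbitrary: p q)
    case 0
    define G where "G = rec_nat (p, q) (\<lambda>n (x, y).
      (y, ((z - of_real (b n)) * y - of_real (prev_coeff a n) * x) / of_real (a n)))"
    have "jacobi_solution a b z (\<lambda>n. fst (G n))"
      unfolding jacobi_solution_def
    proof
      fix n
      have "of_real (a n) \<noteq> (0 :: complex)" using a[of n] by simp
      then show "of_real (prev_coeff a n) * fst (G n) + of_real (b n) * fst (G (n + 1)) + of_real (a n) * fst (G (n + 2))
          = z * fst (G (n + 1))"
        by (simp add: G_def case_prod_beta field_simps)
    qed
    moreover have "fst (G 0) = p" "fst (G (Suc 0)) = q" by (simp_all add: G_def)
    ultimately show ?case by blast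
  next
    case (Suc n)
    \<comment> \<open>The value at \<open>n\<close> comes from solving the equation at
      \<open>n\<close> for its first term, so that the equation in turn forces the value
      \<open>q\<close> two positions later.\<close>
    obtain F where F: "jacobi_solution a b z F"
        "F n = ((z - of_real (b n)) * p - of_real (a n) * q) / of_real (prev_coeff a n)" "F (Suc n) = p"
      using Suc by blast
    have "of_real (a n) * F (Suc (Suc n)) = of_real (a n) * q"
    proof -
      have "of_real (prev_coeff a n) * F n = (z - of_real (b n)) * p - of_real (a n) * q"
        using F(2) prev_coeff_pos[of a n, OF a] by simp
      then show ?thesis
        using F(1)[unfolded jacobi_solution_def, rule_format, of n] F(3)
        unfolding Suc_eq_plus1[symmetric] add_2_eq_Suc' by algebra
    qed
    then have "F (Suc (Suc n)) = q" using a[of n] by simp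
    then show ?case using F by blast
  qed
  then show ?thesis using that by blast
qed

lemma jacobi_solution_cmult:
  "jacobi_solution a b z F \<Longrightarrow> jacobi_solution a b z (\<lambda>n. c * F n)"
  unfolding jacobi_solution_def by (metis (no_types, opaque_lifting) distrib_left mult.left_commute)

lemma jacobi_solution_diff:
  "\<lbrakk>jacobi_solution a b z F; jacobi_solution a b z G\<rbrakk> \<Longrightarrow> jacobi_solution a b z (\<lambda>n. F n - G n)"
  unfolding jacobi_solution_def by (simp add: right_diff_distrib) (metis add_diff_add)

lemma wronskian_cmult_left: "wronskian a (\<lambda>n. c * F n) G = c * wronskian a F G"
  by (simp add: wronskian_def wronskian_at_def algebra_simps)

text \<open>The initial data normalize the constant Wronskian to 1. Dividing that identity by
  \<open>y m * y (Suc m)\<close> gives the increments of \<open>h / y\<close>, and these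
  telescope.\<close>

lemma reduction_of_order:
  assumes a: "\<And>n. a n > 0"
    and y: "jacobi_solution a b z y" and h: "jacobi_solution a b z h"
    and init: "h N = 0" "h (Suc N) = inverse (of_real (prev_coeff a N) * y N)"
    and nz: "\<And>n. n \<ge> N \<Longrightarrow> y n \<noteq> 0"
  shows "wronskian a y h = 1"
    and "n \<ge> N \<Longrightarrow> h n = y n * (\<Sum>m = N..<n. inverse (of_real (prev_coeff a m) * y m * y (Suc m)))"
proof -
  have pn: "of_real (prev_coeff a m) \<noteq> (0 :: complex)" for m using prev_coeff_pos[of a m, OF a] by simp
  have "wronskian_at a y h N = 1"
    using nz[of N] pn[of N] init by (simp add: wronskian_at_def field_simps)
  then show W: "wronskian a y h = 1" using wronskian_at_const[OF y h] by metis
  have step: "h (Suc m) = y (Suc m) * (h m / y m + inverse (of_real (prev_coeff a m) * y m * y (Suc m)))"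
    if "m \<ge> N" for m
  proof -
    have "of_real (prev_coeff a m) * (y m * h (Suc m) - y (Suc m) * h m) = 1"
      using wronskian_at_const[OF y h, of m] W by (simp add: wronskian_at_def)
    then have "y m * h (Suc m) = y (Suc m) * h m + inverse (of_real (prev_coeff a m))"
      using pn[of m] by (simp add: field_simps)
    then have h: "h (Suc m) = (y (Suc m) * h m + inverse (of_real (prev_coeff a m))) / y m"
      using nz[of m] that by (simp add: field_simps)
    show ?thesis
      unfolding h using nz[of m] nz[of "Suc m"] that pn[of m] by (simp add: field_simps)
  qed
  show "h n = y n * (\<Sum>m = N..<n. inverse (of_real (prev_coeff a m) * y m * y (Suc m)))" if "n \<ge> N"
    using that by (induction n rule: dec_induct) (use step init nz in \<open>simp_all add: sum.atLeastLessThan_Suc distrib_left\<close>)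
qed

lemma continuous_on_ortho_poly: "continuous_on K (\<lambda>z. ortho_poly a b z n)"
  by (induction n rule: induct_nat_012) (auto intro!: continuous_intros simp: divide_inverse)

section \<open>Limits of the coefficients and the normalized recurrence\<close>

locale jacobi_coeffs =
  fixes a b :: "nat \<Rightarrow> real" and binf :: real
  assumes a_pos: "\<And>n. a n > 0"
    and a_sum: "summable (\<lambda>n. inverse (a n))"
    and beta_lim: "beta a b \<longlonglongrightarrow> binf" and binf: "\<bar>binf\<bar> > 1"
    and k_sum: "summable (\<lambda>n. \<bar>kcoeff a n - 1\<bar>)"
    and beta_sum: "summable (\<lambda>n. \<bar>beta a b (n + 1) - beta a b n\<bar>)"
begin

lemma a_nz [simp]: "a n \<noteq> 0"
  using a_pos[of n] by simp

text \<open>For \<open>\<bar>beta a b n\<bar> \<ge> 1\<close> this is the root in (0, 1] of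
  \<open>x + 1 / x = 2 * \<bar>beta a b n\<bar>\<close>, the reciprocal of the factor that one step
  adds to \<open>exp (phase a b n)\<close>.\<close>

definition theta :: "nat \<Rightarrow> real" where "theta n = exp (- arcosh \<bar>beta a b n\<bar>)"

definition theta_inf :: real where "theta_inf = exp (- arcosh \<bar>binf\<bar>)"

definition growth :: "nat \<Rightarrow> real" where
  "growth n = sgn binf ^ n / sqrt (a n) * exp (phase a b n)"

text \<open>Literally the comparison sequence in \<open>is_jost_solution\<close>, so that it can be
  folded there. Its argument is the unshifted index, whence the pairing of \<open>f (Suc n)\<close>
  with \<open>decay n\<close>.\<close>

definition decay :: "nat \<Rightarrow> real" where
  "decay n = 1 / sqrt (a n) * sgn binf ^ n * exp (- phase a b n)"

lemma sgn_binf: "sgn binf = 1 \<or> sgn binf = -1"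
  using binf by (auto simp: sgn_real_def)

lemma sgn_binf_sq [simp]: "sgn binf * sgn binf = 1"
  using sgn_binf by auto

lemma growth_nz [simp]: "growth n \<noteq> 0"
  using a_pos[of n] sgn_binf by (auto simp: growth_def)

lemma decay_eq: "decay n = 1 / (a n * growth n)"
proof -
  have "sgn binf ^ n * sgn binf ^ n = 1"
    by (simp only: power_mult_distrib[symmetric] sgn_binf_sq power_one)
  then have "sgn binf ^ n = 1 \<or> sgn binf ^ n = -1" by (simp only: square_eq_1_iff)
  moreover define p where "p = sqrt (a n)"
  moreover have "p > 0" "a n = p * p" using a_pos[of n] by (simp_all add: p_def)
  ultimately show ?thesis
    by (elim disjE) (simp_all add: decay_def growth_def exp_minus field_simps)
qed

lemma decay_nz [simp]: "decay n \<noteq> 0"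
  using a_pos[of n] by (simp add: decay_eq)

lemma theta_eq:
  assumes "\<bar>beta a b n\<bar> \<ge> 1"
  shows "theta n + 1 / theta n = 2 * \<bar>beta a b n\<bar>"
  using cosh_arcosh_real[OF assms] by (simp add: cosh_field_def theta_def exp_minus field_simps)

lemma theta_pos [simp]: "theta n > 0" and theta_nz [simp]: "theta n \<noteq> 0"
  by (simp_all add: theta_def)

lemma theta_le_1: "\<bar>beta a b n\<bar> \<ge> 1 \<Longrightarrow> theta n \<le> 1"
  by (simp add: theta_def)

text \<open>The last equation evaluates twice the hyperbolic sine of
  \<open>arcosh \<bar>binf\<bar>\<close>; it is the source of the square root in the asymptotic
  formula.\<close>

lemma theta_inf: "0 < theta_inf" "theta_inf < 1"
  "1 / theta_inf - theta_inf = 2 * sqrt (binf\<^sup>2 - 1)"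
proof -
  show "0 < theta_inf" "theta_inf < 1"
    using binf arcosh_real_gt_1_iff[of "\<bar>binf\<bar>"] by (auto simp: theta_inf_def)
  show "1 / theta_inf - theta_inf = 2 * sqrt (binf\<^sup>2 - 1)"
    using sinh_arcosh_real[of "\<bar>binf\<bar>"] binf
    by (simp add: sinh_field_def theta_inf_def exp_minus field_simps)
qed

lemma theta_inf_sq: "theta_inf * theta_inf < 1"
  using theta_inf mult_strict_mono[of theta_inf 1 theta_inf 1] by simp

lemma theta_lim: "theta \<longlonglongrightarrow> theta_inf"
proof -
  have "(\<lambda>n. exp (- arcosh \<bar>beta a b n\<bar>)) \<longlonglongrightarrow> exp (- arcosh \<bar>binf\<bar>)"
    using beta_lim binf by (intro tendsto_exp tendsto_minus tendsto_arcosh tendsto_rabs)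
  then show ?thesis by (simp add: theta_def[abs_def] theta_inf_def)
qed

lemma kcoeff_lim: "kcoeff a \<longlonglongrightarrow> 1"
  using summable_LIMSEQ_zero[OF k_sum] by (simp add: tendsto_rabs_zero_iff LIM_zero_iff)

lemma kcoeff_Suc: "kcoeff a (Suc n) = sqrt (a (Suc n)) * sqrt (a (Suc n)) / (sqrt (a n) * sqrt (a (Suc (Suc n))))"
  using a_pos[of "Suc n"] by (simp add: kcoeff_def real_sqrt_mult)

lemma kcoeff_pos: "kcoeff a n > 0"
  using a_pos prev_coeff_pos[OF a_pos] by (simp add: kcoeff_def)

lemma varkappa_pos: "varkappa a n > 0"
  using a_pos by (simp add: varkappa_def)

lemma varkappa_Suc: "varkappa a (Suc n) = varkappa a n / kcoeff a (Suc n)"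
  using a_pos[of n] a_pos[of "Suc n"] a_pos[of "Suc (Suc n)"]
  by (simp add: kcoeff_Suc varkappa_def real_sqrt_divide field_simps)

text \<open>Iterating \<open>varkappa_Suc\<close> writes \<open>varkappa a (Suc n)\<close> as
  \<open>varkappa a 0\<close> divided by a product of values of \<open>kcoeff\<close>. Summability
  of \<open>\<bar>kcoeff a n - 1\<bar>\<close> makes that product converge to a nonzero
  limit.\<close>

lemma varkappa_lim: "varkappa a \<longlonglongrightarrow> varkappa_inf a" and varkappa_inf_nz: "varkappa_inf a \<noteq> 0"
proof -
  have nz: "kcoeff a (Suc n) \<noteq> 0" for n using kcoeff_pos[of "Suc n"] by simp
  have "summable (\<lambda>n. norm (kcoeff a (Suc n) - 1))"
    using summable_ignore_initial_segment[OF k_sum, of 1] by simp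
  then have "convergent_prod (\<lambda>n. kcoeff a (Suc n))"
    by (intro abs_convergent_prod_imp_convergent_prod summable_imp_abs_convergent_prod)
  then obtain L where L: "(\<lambda>n. \<Prod>i\<le>n. kcoeff a (Suc i)) \<longlonglongrightarrow> L" "L \<noteq> 0"
    using convergent_prod_iff_nz_lim[of "\<lambda>n. kcoeff a (Suc n)"] nz by auto
  have "varkappa a (Suc n) = varkappa a 0 / (\<Prod>i\<le>n. kcoeff a (Suc i))" for n
    by (induction n) (simp_all add: varkappa_Suc)
  then have "(\<lambda>n. varkappa a (Suc n)) \<longlonglongrightarrow> varkappa a 0 / L"
    using L by (auto intro!: tendsto_intros)
  then have lim: "varkappa a \<longlonglongrightarrow> varkappa a 0 / L" by (rule LIMSEQ_imp_Suc)
  then have "varkappa_inf a = varkappa a 0 / L" by (simp add: varkappa_inf_def limI)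
  then show "varkappa a \<longlonglongrightarrow> varkappa_inf a" "varkappa_inf a \<noteq> 0"
    using lim L(2) varkappa_pos[of 0] by auto
qed

lemma phase_Suc:
  assumes "\<bar>beta a b n\<bar> \<ge> 1"
  shows "phase a b (Suc n) = phase a b n + arcosh \<bar>beta a b n\<bar>"
proof -
  have "{m. m < Suc n \<and> \<bar>beta a b m\<bar> \<ge> 1} = insert n {m. m < n \<and> \<bar>beta a b m\<bar> \<ge> 1}"
    using assms by (auto simp: less_Suc_eq)
  then show ?thesis by (simp add: phase_def)
qed

lemma growth_Suc:
  assumes "\<bar>beta a b n\<bar> \<ge> 1"
  shows "growth (Suc n) = sgn binf / (varkappa a n * theta n) * growth n"
  using a_pos[of n] a_pos[of "Suc n"]
  by (simp add: growth_def phase_Suc[OF assms] exp_add theta_def exp_minus varkappa_def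
      real_sqrt_divide field_simps)

lemma eventually_beta: "eventually (\<lambda>n. \<bar>beta a b n\<bar> \<ge> 1 \<and> beta a b n = sgn binf * \<bar>beta a b n\<bar>) sequentially"
proof -
  have "(\<lambda>n. sgn binf * beta a b n) \<longlonglongrightarrow> sgn binf * binf"
    using beta_lim by (intro tendsto_intros)
  moreover have "sgn binf * binf > 1" using binf by (simp add: sgn_mult_abs abs_sgn mult.commute)
  ultimately have "eventually (\<lambda>n. sgn binf * beta a b n > 1) sequentially"
    by (rule order_tendstoD)
  then show ?thesis by eventually_elim (use sgn_binf in auto)
qed

lemma eventually_start:
  obtains N where "\<And>n. n \<ge> N \<Longrightarrow> \<bar>beta a b n\<bar> \<ge> 1 \<and> beta a b n = sgn binf * \<bar>beta a b n\<bar>"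
  using eventually_beta unfolding eventually_sequentially by blast

text \<open>The normalization by \<open>growth\<close> is made for this: with \<open>kcoeff\<close>
  and \<open>theta\<close> replaced by their limits and \<open>z = 0\<close>, constant sequences
  solve the recurrence. The sign of \<open>beta\<close> is prescribed at \<open>Suc n\<close>, the
  index of the diagonal coefficient involved.\<close>

lemma normalized_recurrence:
  assumes F: "jacobi_solution a b z F"
    and beta: "\<bar>beta a b n\<bar> \<ge> 1" "\<bar>beta a b (Suc n)\<bar> \<ge> 1"
      "beta a b (Suc n) = sgn binf * \<bar>beta a b (Suc n)\<bar>"
  defines "v \<equiv> \<lambda>k. F (Suc k) / of_real (growth k)"
  shows "of_real (kcoeff a (Suc n)) * v (n + 2)
      = (1 + of_real (theta (Suc n) ^ 2) + z * of_real (sgn binf * theta (Suc n) / (sqrt (a n) * sqrt (a (Suc n))))) * v (n + 1)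
        - of_real (theta n * theta (Suc n)) * v n"
proof -
  define p q r where "p = sqrt (a n)" and "q = sqrt (a (Suc n))" and "r = sqrt (a (Suc (Suc n)))"
  have pqr: "p > 0" "q > 0" "r > 0" "a n = p * p" "a (Suc n) = q * q"
    using a_pos[of n] a_pos[of "Suc n"] a_pos[of "Suc (Suc n)"] by (simp_all add: p_def q_def r_def)
  define g t0 t1 s where "g = growth n" and "t0 = theta n" and "t1 = theta (Suc n)" and "s = sgn binf"
  have nz: "p \<noteq> 0" "q \<noteq> 0" "r \<noteq> 0" "g \<noteq> 0" "t0 \<noteq> 0" "t1 \<noteq> 0"
    using pqr by (auto simp: g_def t0_def t1_def)
  have g1: "growth (Suc n) = s * p / (q * t0) * g"
    unfolding growth_Suc[OF beta(1)] by (simp add: varkappa_def real_sqrt_divide p_def q_def s_def t0_def g_def)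
  have g2: "growth (Suc (Suc n)) = p / (r * t0 * t1) * g"
    unfolding growth_Suc[OF beta(2)] g1 using nz sgn_binf
    by (auto simp: varkappa_def real_sqrt_divide q_def[symmetric] r_def[symmetric] s_def t1_def field_simps)
  have "b (Suc n) = - 2 * (p * q) * beta a b (Suc n)"
    using pqr by (simp add: beta_def real_sqrt_mult)
  also have "\<dots> = - s * (p * q) * (2 * \<bar>beta a b (Suc n)\<bar>)"
    by (subst beta(3)) (simp add: s_def)
  also have "\<dots> = - s * (p * q) * (t1 + 1 / t1)"
    using theta_eq[OF beta(2)] by (simp add: t1_def)
  finally have b1: "b (Suc n) = - s * (p * q) * (t1 + 1 / t1)" .
  have k: "kcoeff a (Suc n) = q * q / (p * r)" by (simp add: kcoeff_Suc p_def q_def r_def)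
  have Fv: "F (Suc k) = v k * of_real (growth k)" for k by (simp add: v_def)
  have J: "of_real (p * p) * (v n * of_real g)
      + of_real (- s * (p * q) * (t1 + 1 / t1)) * (v (Suc n) * of_real (s * p / (q * t0) * g))
      + of_real (q * q) * (v (Suc (Suc n)) * of_real (p / (r * t0 * t1) * g))
      = z * (v (Suc n) * of_real (s * p / (q * t0) * g))"
    using F[unfolded jacobi_solution_def, rule_format, of "Suc n"]
    by (simp only: prev_coeff_Suc Suc_eq_plus1[symmetric] add_2_eq_Suc' Fv b1 pqr(4,5) g1 g2 g_def[symmetric])
  have "of_real (q * q / (p * r)) * v (Suc (Suc n))
      = (1 + of_real (t1 ^ 2) + z * of_real (s * t1 / (p * q))) * v (Suc n)
        - of_real (t0 * t1) * v n"
  proof -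
    have "s = 1 \<or> s = -1" using sgn_binf by (simp add: s_def)
    \<comment> \<open>The difference of the two sides is the Jacobi equation at \<open>Suc n\<close>
      multiplied by \<open>t0 * t1 / (p * p * g)\<close>.\<close>
    then have "of_real (q * q / (p * r)) * v (Suc (Suc n))
      - ((1 + of_real (t1 ^ 2) + z * of_real (s * t1 / (p * q))) * v (Suc n) - of_real (t0 * t1) * v n)
      = (of_real (p * p) * (v n * of_real g)
      + of_real (- s * (p * q) * (t1 + 1 / t1)) * (v (Suc n) * of_real (s * p / (q * t0) * g))
      + of_real (q * q) * (v (Suc (Suc n)) * of_real (p / (r * t0 * t1) * g))
      - z * (v (Suc n) * of_real (s * p / (q * t0) * g))) * of_real (t0 * t1 / (p * p * g))"
      using nz by (elim disjE) (simp_all add: field_simps power2_eq_square)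
    then show ?thesis by (simp only: J diff_self mult_zero_left right_minus_eq)
  qed
  then show ?thesis by (simp add: k s_def t0_def t1_def p_def q_def)
qed

text \<open>For consecutive values \<open>x\<close>, \<open>y\<close> of \<open>theta\<close>, the
  difference of \<open>x + 1 / x\<close> and \<open>y + 1 / y\<close> is
  \<open>(y - x) * (1 - x * y) / (x * y)\<close>. As \<open>x * y\<close> tends to
  \<open>theta_inf * theta_inf < 1\<close>, the factor \<open>1 - x * y\<close> stays away from 0,
  and the variation of \<open>beta\<close> controls that of \<open>theta\<close>.\<close>

lemma theta_sum: "summable (\<lambda>n. \<bar>theta (Suc n) - theta n\<bar>)"
proof -
  define \<rho> where "\<rho> = (1 + theta_inf * theta_inf) / 2"
  have \<rho>: "theta_inf * theta_inf < \<rho>" "\<rho> < 1" using theta_inf_sq by (simp_all add: \<rho>_def)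
  have "(\<lambda>n. theta n * theta (Suc n)) \<longlonglongrightarrow> theta_inf * theta_inf"
    using theta_lim by (intro tendsto_intros LIMSEQ_Suc)
  then have ev: "eventually (\<lambda>n. theta n * theta (Suc n) < \<rho>) sequentially"
    using \<rho>(1) by (rule order_tendstoD)
  obtain N where N: "\<And>n. n \<ge> N \<Longrightarrow> \<bar>beta a b n\<bar> \<ge> 1 \<and> beta a b n = sgn binf * \<bar>beta a b n\<bar>"
    using eventually_start by blast
  have "eventually (\<lambda>n. norm \<bar>theta (Suc n) - theta n\<bar> \<le> 2 / (1 - \<rho>) * \<bar>beta a b (n + 1) - beta a b n\<bar>) sequentially"
    using ev eventually_ge_at_top[of N]
  proof eventually_elim
    case (elim n)
    define x y where "x = theta n" and "y = theta (Suc n)"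
    have xy: "x > 0" "y > 0" "x \<le> 1" "y \<le> 1" "x * y < \<rho>"
      using elim N[of n] N[of "Suc n"] theta_le_1[of n] theta_le_1[of "Suc n"] by (auto simp: x_def y_def)
    have xy1: "x * y \<le> 1" using xy by (simp add: mult_le_one)
    define \<delta> where "\<delta> = \<bar>beta a b n\<bar> - \<bar>beta a b (Suc n)\<bar>"
    have "2 * \<delta> = x + 1 / x - (y + 1 / y)"
      using theta_eq[of n] theta_eq[of "Suc n"] N[of n] N[of "Suc n"] elim by (simp add: x_def y_def \<delta>_def)
    then have "(y - x) * (1 - x * y) = 2 * \<delta> * (x * y)" using xy by (simp add: field_simps)
    then have "\<bar>y - x\<bar> * \<bar>1 - x * y\<bar> = \<bar>2\<bar> * \<bar>\<delta>\<bar> * \<bar>x * y\<bar>" by (simp only: abs_mult[symmetric])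
    then have "\<bar>y - x\<bar> * (1 - x * y) = 2 * \<bar>\<delta>\<bar> * (x * y)" using xy xy1 by simp
    also have "\<dots> \<le> 2 * \<bar>beta a b (Suc n) - beta a b n\<bar> * 1"
      using xy xy1 abs_triangle_ineq3[of "beta a b n" "beta a b (Suc n)"]
      by (intro mult_mono mult_left_mono) (auto simp: \<delta>_def abs_minus_commute)
    finally have "\<bar>y - x\<bar> * (1 - x * y) \<le> 2 * \<bar>beta a b (Suc n) - beta a b n\<bar>" by simp
    moreover have "\<bar>y - x\<bar> * (1 - \<rho>) \<le> \<bar>y - x\<bar> * (1 - x * y)"
      using xy by (intro mult_left_mono) auto
    ultimately show ?case using \<rho> by (simp add: x_def y_def field_simps)
  qed
  then show ?thesis
    by (rule summable_comparison_test_ev) (rule summable_mult[OF beta_sum])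
qed

lemma inverse_sqrt_sum: "summable (\<lambda>n. 1 / (sqrt (a n) * sqrt (a (Suc n))))"
proof (rule summable_comparison_test'[where N = 0])
  show "summable (\<lambda>n. inverse (a n) + inverse (a (Suc n)))"
    using a_sum summable_ignore_initial_segment[OF a_sum, of 1] by (intro summable_add) simp_all
  show "norm (1 / (sqrt (a n) * sqrt (a (Suc n)))) \<le> inverse (a n) + inverse (a (Suc n))" for n
  proof -
    define x y where "x = 1 / sqrt (a n)" and "y = 1 / sqrt (a (Suc n))"
    have "x * x = inverse (a n)" "y * y = inverse (a (Suc n))"
      using a_pos[of n] a_pos[of "Suc n"] by (simp_all add: x_def y_def field_simps)
    moreover have "x * y \<le> x * x + y * y"
      using sum_squares_bound[of x y, unfolded power2_eq_square] zero_le_square[of x] zero_le_square[of y]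
      by linarith
    moreover have "1 / (sqrt (a n) * sqrt (a (Suc n))) = x * y" by (simp add: x_def y_def)
    moreover have "x * y \<ge> 0" using a_pos[of n] a_pos[of "Suc n"] by (simp add: x_def y_def)
    ultimately show ?thesis by simp
  qed
qed

text \<open>The terms of \<open>normalized_recurrence\<close> are regrouped into increments of the
  normalized solution and a remainder \<open>R\<close> times its value. The parameter
  \<open>z\<close> enters the bounds through \<open>M\<close> alone, which makes them uniform on
  bounded sets.\<close>

lemma perturbation_bounds:
  fixes M :: real
  assumes M: "0 \<le> M"
  obtains \<rho> e N where "0 \<le> \<rho>" "\<rho> < 1" "\<And>n. 0 \<le> e n" "summable e"
    and "\<And>n z F. \<lbrakk>n \<ge> N; norm z \<le> M; jacobi_solution a b z F\<rbrakk> \<Longrightarrow>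
      norm (F (n + 3) / of_real (growth (n + 2)) - F (n + 2) / of_real (growth (n + 1)))
      \<le> \<rho> * norm (F (n + 2) / of_real (growth (n + 1)) - F (n + 1) / of_real (growth n))
         + e n * norm (F (n + 2) / of_real (growth (n + 1)))"
proof -
  \<comment> \<open>The midpoint between 1 and the limit of the contraction factor.\<close>
  define \<rho> where "\<rho> = (1 + theta_inf * theta_inf) / 2"
  have \<rho>: "theta_inf * theta_inf / 1 < \<rho>" "0 \<le> \<rho>" "\<rho> < 1" using theta_inf_sq by (simp_all add: \<rho>_def)
  \<comment> \<open>The factor 2 absorbs the division by \<open>kcoeff a (Suc n)\<close>, which
    eventually exceeds 1/2.\<close>
  define e where "e n = 2 * (\<bar>kcoeff a (Suc n) - 1\<bar> + \<bar>theta (Suc n) - theta n\<bar>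
      + M * (1 / (sqrt (a n) * sqrt (a (Suc n)))))" for n
  have "summable (\<lambda>n. \<bar>kcoeff a (Suc n) - 1\<bar>)"
    using k_sum by (simp only: summable_Suc_iff[of "\<lambda>n. \<bar>kcoeff a n - 1\<bar>"])
  then have e_sum: "summable e"
    unfolding e_def by (intro summable_mult summable_add theta_sum inverse_sqrt_sum)
  have e_nonneg: "0 \<le> e n" for n
    unfolding e_def using M a_pos[of n] a_pos[of "Suc n"]
    by (intro mult_nonneg_nonneg add_nonneg_nonneg) auto
  have "(\<lambda>n. theta n * theta (Suc n) / kcoeff a (Suc n)) \<longlonglongrightarrow> theta_inf * theta_inf / 1"
    using theta_lim kcoeff_lim by (intro tendsto_intros LIMSEQ_Suc) auto
  then have ev1: "eventually (\<lambda>n. theta n * theta (Suc n) / kcoeff a (Suc n) < \<rho>) sequentially"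
    using \<rho>(1) by (rule order_tendstoD)
  have ev2: "eventually (\<lambda>n. kcoeff a (Suc n) > 1 / 2) sequentially"
    by (rule order_tendstoD(1)[OF LIMSEQ_Suc[OF kcoeff_lim]]) simp
  obtain N0 where N0: "\<And>n. n \<ge> N0 \<Longrightarrow> \<bar>beta a b n\<bar> \<ge> 1 \<and> beta a b n = sgn binf * \<bar>beta a b n\<bar>"
    using eventually_start by blast
  obtain N where N: "\<And>n. n \<ge> N \<Longrightarrow> theta n * theta (Suc n) / kcoeff a (Suc n) < \<rho>
      \<and> kcoeff a (Suc n) > 1 / 2 \<and> n \<ge> N0"
    using eventually_conj[OF ev1 eventually_conj[OF ev2 eventually_ge_at_top[of N0]]]
    unfolding eventually_sequentially by blast
  have "norm (F (n + 3) / of_real (growth (n + 2)) - F (n + 2) / of_real (growth (n + 1)))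
      \<le> \<rho> * norm (F (n + 2) / of_real (growth (n + 1)) - F (n + 1) / of_real (growth n))
         + e n * norm (F (n + 2) / of_real (growth (n + 1)))"
    if n: "n \<ge> N" and z: "norm z \<le> M" and F: "jacobi_solution a b z F" for n z F
  proof -
    define v where "v k = F (Suc k) / of_real (growth k)" for k
    define k t0 t1 w where "k = kcoeff a (Suc n)" and "t0 = theta n" and "t1 = theta (Suc n)"
      and "w = 1 / (sqrt (a n) * sqrt (a (Suc n)))"
    have k: "k > 1 / 2" "t0 * t1 / k < \<rho>" and n0: "n \<ge> N0"
      using N[OF n] by (auto simp: k_def t0_def t1_def)
    have t: "t0 > 0" "0 < t1" "t1 \<le> 1"
      using N0[of "Suc n"] theta_le_1[of "Suc n"] n0 by (auto simp: t0_def t1_def)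
    have w: "w \<ge> 0" using a_pos[of n] a_pos[of "Suc n"] by (simp add: w_def)
    \<comment> \<open>What is left as coefficient of \<open>v (n + 1)\<close> once
      \<open>k * v (n + 1)\<close> is subtracted and \<open>t0 * t1 * (v (n + 1) - v n)\<close> is
      split off.\<close>
    define R where "R = of_real (1 - k) + of_real (t1 * (t1 - t0)) + z * of_real (sgn binf * t1 * w)"
    have "of_real k * v (n + 2)
        = (1 + of_real (t1 ^ 2) + z * of_real (sgn binf * t1 * w)) * v (n + 1) - of_real (t0 * t1) * v n"
      using normalized_recurrence[OF F, of n] N0[of n] N0[of "Suc n"] n0
      by (simp add: v_def k_def t0_def t1_def w_def)
    then have "of_real k * (v (n + 2) - v (n + 1)) = of_real (t0 * t1) * (v (n + 1) - v n) + R * v (n + 1)"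
      by (simp add: R_def algebra_simps power2_eq_square)
    then have "v (n + 2) - v (n + 1) = (of_real (t0 * t1) * (v (n + 1) - v n) + R * v (n + 1)) / of_real k"
      using k by (simp add: field_simps)
    also have "\<dots> = of_real (t0 * t1 / k) * (v (n + 1) - v n) + R / of_real k * v (n + 1)"
      by (simp add: add_divide_distrib)
    also have "norm \<dots> \<le> norm (of_real (t0 * t1 / k) * (v (n + 1) - v n)) + norm (R / of_real k * v (n + 1))"
      by (rule norm_triangle_ineq)
    also have "\<dots> = (t0 * t1 / k) * norm (v (n + 1) - v n) + norm R / k * norm (v (n + 1))"
      using k t by (simp add: norm_mult norm_divide)
    also have "\<dots> \<le> \<rho> * norm (v (n + 1) - v n) + e n * norm (v (n + 1))"
    proof (intro add_mono mult_right_mono)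
      have "norm R \<le> norm (of_real (1 - k) :: complex) + norm (of_real (t1 * (t1 - t0)) :: complex)
          + norm (z * of_real (sgn binf * t1 * w))"
        unfolding R_def by (intro order_trans[OF norm_triangle_ineq] add_right_mono norm_triangle_ineq)
      also have "\<dots> = \<bar>k - 1\<bar> + t1 * \<bar>t1 - t0\<bar> + norm z * (t1 * w)"
        using t w sgn_binf unfolding norm_mult norm_of_real by (auto simp: abs_mult abs_minus_commute)
      also have "\<dots> \<le> \<bar>k - 1\<bar> + 1 * \<bar>t1 - t0\<bar> + M * (1 * w)"
        using t w M z by (intro add_mono mult_mono mult_right_mono order_refl) auto
      also have "\<dots> = e n / 2" by (simp add: e_def k_def t0_def t1_def w_def)
      finally have "norm R \<le> e n / 2" .
      also have "e n / 2 \<le> e n * k" using k e_nonneg[of n] mult_left_mono[of "1/2" k "e n"] by simp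
      finally show "norm R / k \<le> e n" using k by (simp add: field_simps)
    qed (use k in auto)
    finally show ?thesis by (simp add: v_def numeral_3_eq_3)
  qed
  then show ?thesis using that[OF \<rho>(2,3) e_nonneg e_sum] by blast
qed

subsection \<open>The Jost solution\<close>

lemma normalized_uniform_limit:
  assumes M: "\<And>z. z \<in> K \<Longrightarrow> norm z \<le> M"
    and F: "\<And>z. z \<in> K \<Longrightarrow> jacobi_solution a b z (F z)"
    and bdd: "\<And>n. \<exists>B. \<forall>z\<in>K. norm (F z n) \<le> B"
  obtains V where "uniform_limit K (\<lambda>n z. F z (Suc n) / of_real (growth n)) V sequentially"
proof -
  have M': "0 \<le> max 0 M" by simp
  obtain \<rho> e N where \<rho>: "0 \<le> \<rho>" "\<rho> < 1" and e: "\<And>n. 0 \<le> e n" "summable e"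
    and step: "\<And>n z F. \<lbrakk>n \<ge> N; norm z \<le> max 0 M; jacobi_solution a b z F\<rbrakk> \<Longrightarrow>
      norm (F (n + 3) / of_real (growth (n + 2)) - F (n + 2) / of_real (growth (n + 1)))
      \<le> \<rho> * norm (F (n + 2) / of_real (growth (n + 1)) - F (n + 1) / of_real (growth n))
         + e n * norm (F (n + 2) / of_real (growth (n + 1)))"
    using perturbation_bounds[OF M'] by blast
  show ?thesis
  proof (rule perturbed_recurrence_uniform_limit[OF \<rho> e, of K "\<lambda>n z. F z (Suc n) / of_real (growth n)" N])
    show "\<exists>B. \<forall>z\<in>K. norm (F z (Suc n) / of_real (growth n)) \<le> B" for n
    proof -
      obtain B where "\<forall>z\<in>K. norm (F z (Suc n)) \<le> B" using bdd by blast
      then have "\<forall>z\<in>K. norm (F z (Suc n) / of_real (growth n)) \<le> B / \<bar>growth n\<bar>"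
        by (auto simp: norm_divide intro!: divide_right_mono)
      then show ?thesis by blast
    qed
    show "norm (F z (Suc (n + 2)) / of_real (growth (n + 2)) - F z (Suc (n + 1)) / of_real (growth (n + 1)))
      \<le> \<rho> * norm (F z (Suc (n + 1)) / of_real (growth (n + 1)) - F z (Suc n) / of_real (growth n))
         + e n * norm (F z (Suc (n + 1)) / of_real (growth (n + 1)))" if "n \<ge> N" "z \<in> K" for n z
      using step[OF that(1) order_trans[OF M[OF that(2)]] F[OF that(2)]] by (simp add: numeral_3_eq_3)
  qed (rule that)
qed

lemma normalized_limit:
  assumes "jacobi_solution a b z F"
  obtains V where "(\<lambda>n. F (Suc n) / of_real (growth n)) \<longlonglongrightarrow> V"
proof -
  obtain V where "uniform_limit {z} (\<lambda>n _. F (Suc n) / of_real (growth n)) V sequentially"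
    using normalized_uniform_limit[of "{z}" "norm z" "\<lambda>_. F"] assms by auto
  then show ?thesis by (intro that tendsto_uniform_limitI) auto
qed

text \<open>A solution with normalized values 1 at two consecutive positions far out has zero
  initial increment there. The lower bound in \<open>perturbed_recurrence_bounds\<close> then reads
  1 - 1/2, so the limit has norm at least 1/2.\<close>

lemma dominant_solution_exists:
  obtains y V where "jacobi_solution a b z y" "(\<lambda>n. y (Suc n) / of_real (growth n)) \<longlonglongrightarrow> V" "V \<noteq> 0"
proof -
  obtain \<rho> e N0 where \<rho>: "0 \<le> \<rho>" "\<rho> < 1" and e: "\<And>n. 0 \<le> e n" "summable e"
    and step: "\<And>n z' F. \<lbrakk>n \<ge> N0; norm z' \<le> norm z; jacobi_solution a b z' F\<rbrakk> \<Longrightarrow>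
      norm (F (n + 3) / of_real (growth (n + 2)) - F (n + 2) / of_real (growth (n + 1)))
      \<le> \<rho> * norm (F (n + 2) / of_real (growth (n + 1)) - F (n + 1) / of_real (growth n))
         + e n * norm (F (n + 2) / of_real (growth (n + 1)))"
    using perturbation_bounds[OF norm_ge_zero[of z]] by blast
  have "summable (\<lambda>n. e (n + N0))"
    using e by (rule_tac summable_ignore_initial_segment)
  then obtain N1 where N1: "\<And>n. (\<Sum>i<n. e (i + N1 + N0)) \<le> (1 - \<rho>) / 4"
    using e(1) \<rho>(2) small_tail_sums[of "\<lambda>n. e (n + N0)" "(1 - \<rho>) / 4"] by auto
  define N where "N = N1 + N0"
  obtain y where y: "jacobi_solution a b z y" "y (Suc N) = of_real (growth N)"
      "y (Suc (Suc N)) = of_real (growth (Suc N))"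
    using jacobi_solution_exists[of a b z "Suc N"] a_pos by metis
  define v where "v n = y (Suc (n + N)) / of_real (growth (n + N))" for n
  have v01: "v 0 = 1" "v 1 = 1" by (simp_all add: v_def y)
  have vn: "norm (v (n + 1)) \<ge> 1 / 2" for n
  proof -
    have "norm (v 1) - \<rho> / (1 - \<rho>) * norm (v 1 - v 0)
        - (norm (v 1) + \<rho> / (1 - \<rho>) * norm (v 1 - v 0)) / 2 \<le> norm (v (n + 1))"
    proof (rule perturbed_recurrence_bounds(2)[OF \<rho>, where e = "\<lambda>n. e (n + N)"])
      show "(\<Sum>i<n. e (i + N)) \<le> (1 - \<rho>) / 4" for n
        using N1[of n] by (simp add: N_def add_ac)
      show "norm (v (n + 2) - v (n + 1)) \<le> \<rho> * norm (v (n + 1) - v n) + e (n + N) * norm (v (n + 1))" for n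
        using step[OF _ order_refl y(1), of "n + N"] by (simp add: v_def N_def add_ac numeral_3_eq_3)
    qed (rule e)
    then show ?thesis by (simp only: v01) simp
  qed
  obtain V where V: "(\<lambda>n. y (Suc n) / of_real (growth n)) \<longlonglongrightarrow> V"
    using normalized_limit[OF y(1)] .
  have "(\<lambda>n. norm (v (n + 1))) \<longlonglongrightarrow> norm V"
    using LIMSEQ_ignore_initial_segment[OF tendsto_norm[OF V], of "Suc N"] by (simp add: v_def)
  then have "1 / 2 \<le> norm V" by (rule LIMSEQ_le_const) (use vn in auto)
  then have "V \<noteq> 0" by auto
  then show ?thesis using that y(1) V by blast
qed

section \<open>Wronskians of growing and decaying solutions\<close>

lemma growth_decay_lims:
  "(\<lambda>n. a n * growth (Suc n) * decay n) \<longlonglongrightarrow> sgn binf / (varkappa_inf a * theta_inf)"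
  "(\<lambda>n. a n * growth n * decay (Suc n)) \<longlonglongrightarrow> sgn binf * theta_inf / varkappa_inf a"
proof -
  have ev: "eventually (\<lambda>n. \<bar>beta a b n\<bar> \<ge> 1) sequentially"
    by (rule eventually_mono[OF eventually_beta]) blast
  have "(\<lambda>n. sgn binf / (varkappa a n * theta n)) \<longlonglongrightarrow> sgn binf / (varkappa_inf a * theta_inf)"
    using varkappa_lim varkappa_inf_nz theta_lim theta_inf(1) by (intro tendsto_intros) auto
  moreover have "eventually (\<lambda>n. sgn binf / (varkappa a n * theta n) = a n * growth (Suc n) * decay n) sequentially"
    using ev by eventually_elim (simp add: growth_Suc decay_eq)
  ultimately show "(\<lambda>n. a n * growth (Suc n) * decay n) \<longlonglongrightarrow> sgn binf / (varkappa_inf a * theta_inf)"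
    by (rule Lim_transform_eventually)
  have "(\<lambda>n. sgn binf * theta n / varkappa a n) \<longlonglongrightarrow> sgn binf * theta_inf / varkappa_inf a"
    using varkappa_lim varkappa_inf_nz theta_lim by (intro tendsto_intros) auto
  moreover have "eventually (\<lambda>n. sgn binf * theta n / varkappa a n = a n * growth n * decay (Suc n)) sequentially"
    using ev
  proof eventually_elim
    case (elim n)
    have k: "varkappa a n > 0" "varkappa a n * varkappa a n = a (Suc n) / a n"
      using a_pos[of n] a_pos[of "Suc n"] by (simp_all add: varkappa_pos) (simp add: varkappa_def)
    have "a (Suc n) = varkappa a n * varkappa a n * a n" using k a_pos[of n] by simp
    then show ?case
      unfolding decay_eq growth_Suc[OF elim]
      using k(1) a_pos[of n] sgn_binf growth_nz[of n] theta_nz[of n]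
      by (elim disjE) (simp_all add: field_simps del: growth_nz theta_nz)
  qed
  ultimately show "(\<lambda>n. a n * growth n * decay (Suc n)) \<longlonglongrightarrow> sgn binf * theta_inf / varkappa_inf a"
    by (rule Lim_transform_eventually)
qed

text \<open>The Wronskian is constant, hence equal to its limit, which the two products in
  \<open>growth_decay_lims\<close> determine. They contribute the difference
  \<open>theta_inf - 1 / theta_inf\<close>, which is minus
  \<open>2 * sqrt (binf\<^sup>2 - 1)\<close>.\<close>

lemma wronskian_growth_decay:
  assumes F: "jacobi_solution a b z F" and f: "jacobi_solution a b z f"
    and V: "(\<lambda>n. F (Suc n) / of_real (growth n)) \<longlonglongrightarrow> V"
    and U: "(\<lambda>n. f (Suc n) / of_real (decay n)) \<longlonglongrightarrow> U"
  shows "wronskian a F f = - (V * U * of_real (2 * sgn binf * sqrt (binf\<^sup>2 - 1) / varkappa_inf a))"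
proof -
  define v u where "v n = F (Suc n) / of_real (growth n)" and "u n = f (Suc n) / of_real (decay n)" for n
  have vV: "v \<longlonglongrightarrow> V" and uU: "u \<longlonglongrightarrow> U" using V U by (simp_all add: v_def[abs_def] u_def[abs_def])
  have "(\<lambda>n. of_real (a n * growth n * decay (Suc n)) * (v n * u (Suc n))
        - of_real (a n * growth (Suc n) * decay n) * (v (Suc n) * u n))
      \<longlonglongrightarrow> of_real (sgn binf * theta_inf / varkappa_inf a) * (V * U)
        - of_real (sgn binf / (varkappa_inf a * theta_inf)) * (V * U)"
    using vV uU growth_decay_lims by (intro tendsto_intros LIMSEQ_Suc)
  moreover have "of_real (a n * growth n * decay (Suc n)) * (v n * u (Suc n))
        - of_real (a n * growth (Suc n) * decay n) * (v (Suc n) * u n) = wronskian a F f" for n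
  proof -
    have "F (Suc k) = of_real (growth k) * v k" "f (Suc k) = of_real (decay k) * u k" for k
      by (simp_all add: v_def u_def)
    then show ?thesis
      using wronskian_at_const[OF F f, of "Suc n"] by (simp add: wronskian_at_def algebra_simps)
  qed
  ultimately have "wronskian a F f = of_real (sgn binf * theta_inf / varkappa_inf a) * (V * U)
        - of_real (sgn binf / (varkappa_inf a * theta_inf)) * (V * U)"
    by (simp add: LIMSEQ_const_iff)
  also have "\<dots> = - (V * U * of_real (sgn binf / varkappa_inf a * (1 / theta_inf - theta_inf)))"
    by (simp add: algebra_simps)
  also have "\<dots> = - (V * U * of_real (2 * sgn binf * sqrt (binf\<^sup>2 - 1) / varkappa_inf a))"
    unfolding theta_inf(3) by (simp add: mult_ac)
  finally show ?thesis .
qed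

text \<open>Asymptotic equivalence counts 0/0 as 1; since \<open>decay\<close> never vanishes, it
  reduces to the limit of the quotient.\<close>

lemma is_jost_solution_iff:
  "is_jost_solution a b binf z f \<longleftrightarrow>
     jacobi_solution a b z f \<and> (\<lambda>n. f (Suc n) / of_real (decay n)) \<longlonglongrightarrow> 1"
  by (simp only: is_jost_solution_def asymp_equiv_def decay_def[symmetric] Suc_eq_plus1[symmetric]
      of_real_eq_0_iff decay_nz simp_thms if_False)

text \<open>The quotient is \<open>exp (- 2 * phase a b n)\<close>. Its successive ratios tend to
  \<open>theta_inf * theta_inf < 1\<close>, so it is even summable.\<close>

lemma decay_over_growth: "(\<lambda>n. decay n / growth n) \<longlonglongrightarrow> 0"
proof -
  define c where "c n = exp (- 2 * phase a b n)" for n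
  have "(\<lambda>n. theta n * theta n) \<longlonglongrightarrow> theta_inf * theta_inf"
    using theta_lim by (intro tendsto_intros)
  moreover have "eventually (\<lambda>n. theta n * theta n = c (Suc n) / c n) sequentially"
    using eventually_beta
    by eventually_elim (simp add: c_def theta_def phase_Suc exp_diff[symmetric] exp_add[symmetric] algebra_simps)
  ultimately have "(\<lambda>n. c (Suc n) / c n) \<longlonglongrightarrow> theta_inf * theta_inf"
    by (rule Lim_transform_eventually)
  moreover have "norm (theta_inf * theta_inf) < 1"
    using theta_inf_sq by simp
  ultimately have "summable c"
    by (rule_tac geometric_tail_asymptotics(1)[where N = 0 and q = "theta_inf * theta_inf"]) (auto simp: c_def)
  then have "c \<longlonglongrightarrow> 0" by (rule summable_LIMSEQ_zero)
  moreover have "c = (\<lambda>n. decay n / growth n)"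
  proof
    fix n
    have "c n = exp (- phase a b n) * exp (- phase a b n)" by (simp add: c_def exp_add[symmetric])
    then show "c n = decay n / growth n"
      using sgn_binf a_pos[of n] by (auto simp: decay_def growth_def exp_minus field_simps)
  qed
  ultimately show ?thesis by simp
qed

text \<open>Supplies \<open>V = 0\<close> in \<open>wronskian_growth_decay\<close>, so that two
  decaying solutions have Wronskian zero.\<close>

lemma decaying_normalized_limit:
  assumes "(\<lambda>n. f (Suc n) / of_real (decay n)) \<longlonglongrightarrow> (U :: complex)"
  shows "(\<lambda>n. f (Suc n) / of_real (growth n)) \<longlonglongrightarrow> 0"
proof -
  have "(\<lambda>n. f (Suc n) / of_real (decay n) * of_real (decay n / growth n)) \<longlonglongrightarrow> U * of_real 0"
    by (intro tendsto_intros assms decay_over_growth)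
  then show ?thesis by (simp add: mult.commute)
qed

text \<open>At a position where \<open>f\<close> does not vanish, a zero Wronskian makes
  \<open>F\<close> and the given multiple of \<open>f\<close> agree there and at the next
  position.\<close>

lemma wronskian_zero_imp_multiple:
  assumes F: "jacobi_solution a b z F" and f: "jacobi_solution a b z f"
    and W: "wronskian a F f = 0" and nz: "f n \<noteq> 0"
  shows "F = (\<lambda>m. F n / f n * f m)"
proof (rule jacobi_solution_unique[of a b z, where n = n])
  have "of_real (prev_coeff a n) * (F n * f (Suc n) - F (Suc n) * f n) = 0"
    using wronskian_at_const[OF F f, of n] W by (simp add: wronskian_at_def)
  then show "F (Suc n) = F n / f n * f (Suc n)"
    using prev_coeff_pos[of a n] a_pos nz by (simp add: field_simps)
qed (use a_pos F jacobi_solution_cmult[OF f, of "F n / f n"] nz in simp_all)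

lemma jost_eventually_nonzero:
  assumes "is_jost_solution a b binf z f"
  shows "eventually (\<lambda>n. f (Suc n) \<noteq> 0) sequentially"
proof -
  have "(\<lambda>n. f (Suc n) / of_real (decay n)) \<longlonglongrightarrow> 1" using assms by (simp add: is_jost_solution_iff)
  then have "eventually (\<lambda>n. f (Suc n) / of_real (decay n) \<noteq> 0) sequentially"
    by (rule tendsto_imp_eventually_ne) simp
  then show ?thesis by eventually_elim auto
qed

text \<open>Two Jost solutions have Wronskian zero, hence are proportional, and their common
  normalization at infinity forces the factor 1.\<close>

lemma jost_unique:
  assumes f: "is_jost_solution a b binf z f" and g: "is_jost_solution a b binf z g"
  shows "f = g"
proof -
  have lims: "(\<lambda>n. f (Suc n) / of_real (decay n)) \<longlonglongrightarrow> 1" "(\<lambda>n. g (Suc n) / of_real (decay n)) \<longlonglongrightarrow> 1"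
    and sol: "jacobi_solution a b z f" "jacobi_solution a b z g"
    using f g by (simp_all add: is_jost_solution_iff)
  have "wronskian a f g = 0"
    using wronskian_growth_decay[OF sol decaying_normalized_limit[OF lims(1)] lims(2)] by simp
  moreover obtain n where "g (Suc n) \<noteq> 0"
    using eventually_happens[OF jost_eventually_nonzero[OF g]] by auto
  ultimately obtain c where c: "f = (\<lambda>m. c * g m)"
    using wronskian_zero_imp_multiple[OF sol] by blast
  have "(\<lambda>n. c * (g (Suc n) / of_real (decay n))) \<longlonglongrightarrow> c * 1"
    by (intro tendsto_intros lims)
  then have "c = 1" using LIMSEQ_unique[OF lims(1)] by (simp add: c)
  then show ?thesis by (simp add: c)
qed

text \<open>With \<open>y\<close> dominant, \<open>h\<close> the solution obtained from \<open>y\<close> by reduction of order and \<open>L\<close> the limit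
  of \<open>h / y\<close>, the decaying solution is \<open>h - L * y\<close>, that is, \<open>- y n\<close> times the tail sum of
  \<open>1 / (a m * y m * y (m + 1))\<close>; the terms of that sum behave like a geometric sequence of ratio
  \<open>theta_inf\<^sup>2\<close>.\<close>

lemma jost_exists: "\<exists>f. is_jost_solution a b binf z f"
proof -
  obtain y V where y: "jacobi_solution a b z y" and V: "(\<lambda>n. y (Suc n) / of_real (growth n)) \<longlonglongrightarrow> V" "V \<noteq> 0"
    using dominant_solution_exists .
  define v where "v n = y (Suc n) / of_real (growth n)" for n
  have yv: "y (Suc n) = of_real (growth n) * v n" for n by (simp add: v_def)
  have vV: "v \<longlonglongrightarrow> V" using V by (simp add: v_def[abs_def])
  have "eventually (\<lambda>n. v n \<noteq> 0) sequentially"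
    by (rule tendsto_imp_eventually_ne[OF vV V(2)])
  then obtain N0 where N0: "\<And>n. n \<ge> N0 \<Longrightarrow> v n \<noteq> 0" unfolding eventually_sequentially by blast
  define N where "N = Suc N0"
  have ynz: "y n \<noteq> 0" if "n \<ge> N" for n
    using N0[of "n - 1"] that by (cases n) (auto simp: N_def v_def)
  obtain h where h: "jacobi_solution a b z h" "h N = 0" "h (Suc N) = inverse (of_real (prev_coeff a N) * y N)"
    using jacobi_solution_exists[of a b z N] a_pos by metis
  define c where "c m = inverse (of_real (prev_coeff a m) * y m * y (Suc m))" for m
  have hc: "h n = y n * (\<Sum>m = N..<n. c m)" if "n \<ge> N" for n
    using reduction_of_order(2)[OF a_pos y h ynz that] by (simp add: c_def)
  have cnz: "c n \<noteq> 0" if "n \<ge> N" for n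
    using ynz[OF that] ynz[of "Suc n"] that prev_coeff_pos[of a n] a_pos by (simp add: c_def)
  define q where "q = complex_of_real (theta_inf * theta_inf)"
  have q: "norm q < 1"
    using theta_inf_sq theta_inf(1) by (simp add: q_def norm_mult)
  obtain Nb where Nb: "\<And>n. n \<ge> Nb \<Longrightarrow> \<bar>beta a b n\<bar> \<ge> 1 \<and> beta a b n = sgn binf * \<bar>beta a b n\<bar>"
    using eventually_start by blast
  have "(\<lambda>n. c (Suc n) / c n) \<longlonglongrightarrow> q"
  \<comment> \<open>The shift turns \<open>prev_coeff\<close> into \<open>a\<close> and lets every
    value of \<open>y\<close> be written through \<open>growth\<close> and \<open>v\<close>.\<close>
  proof (rule LIMSEQ_imp_Suc)
    have "(\<lambda>n. of_real (theta n * theta (Suc n) / kcoeff a (Suc n)) * (v n / v (Suc (Suc n))))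
        \<longlonglongrightarrow> of_real (theta_inf * theta_inf / 1) * (V / V)"
      using theta_lim kcoeff_lim vV V(2) by (intro tendsto_intros LIMSEQ_Suc) auto
    moreover have "eventually (\<lambda>n. of_real (theta n * theta (Suc n) / kcoeff a (Suc n)) * (v n / v (Suc (Suc n)))
        = c (Suc (Suc n)) / c (Suc n)) sequentially"
      using eventually_ge_at_top[of N] eventually_ge_at_top[of Nb]
    proof eventually_elim
      case (elim n)
      have nz: "y (Suc n) \<noteq> 0" "y (Suc (Suc n)) \<noteq> 0" "y (Suc (Suc (Suc n))) \<noteq> 0"
        using elim by (auto intro!: ynz)
      have pos: "sqrt (a n) > 0" "sqrt (a (Suc n)) > 0" "sqrt (a (Suc (Suc n))) > 0"
        "a n = sqrt (a n) * sqrt (a n)" "a (Suc n) = sqrt (a (Suc n)) * sqrt (a (Suc n))"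
        using a_pos[of n] a_pos[of "Suc n"] a_pos[of "Suc (Suc n)"] by simp_all
      \<comment> \<open>Over two steps the sign factors cancel and \<open>a (Suc n)\<close> drops
        out.\<close>
      have "growth (Suc (Suc n)) = sqrt (a n) / (sqrt (a (Suc (Suc n))) * theta n * theta (Suc n)) * growth n"
        using Nb[of n] Nb[of "Suc n"] elim growth_Suc[of n] growth_Suc[of "Suc n"] sgn_binf pos(2)
        by (auto simp: varkappa_def real_sqrt_divide field_simps)
      then have "theta n * theta (Suc n) / kcoeff a (Suc n)
          = a n * growth n / (a (Suc n) * growth (Suc (Suc n)))"
        unfolding kcoeff_Suc using pos growth_nz[of n] by (simp add: field_simps)
      then have "of_real (theta n * theta (Suc n) / kcoeff a (Suc n)) * (v n / v (Suc (Suc n)))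
          = of_real (a n) * y (Suc n) / (of_real (a (Suc n)) * y (Suc (Suc (Suc n))))"
        by (simp add: v_def)
      also have "\<dots> = c (Suc (Suc n)) / c (Suc n)"
        using nz pos by (simp add: c_def field_simps)
      finally show ?case .
    qed
    ultimately show "(\<lambda>n. c (Suc (Suc n)) / c (Suc n)) \<longlonglongrightarrow> q"
      using V(2) by (auto simp: q_def intro: Lim_transform_eventually)
  qed
  note tail = geometric_tail_asymptotics[where N = N, OF q cnz this]
  define S where "S n = (\<Sum>m. c (m + n))" for n
  define f where "f n = h n - S N * y n" for n
  have f_jac: "jacobi_solution a b z f"
    unfolding f_def by (intro jacobi_solution_diff jacobi_solution_cmult h y)
  have fS: "f n = - (y n * S n)" if "n \<ge> N" for n
  proof -
    have "S N = (\<Sum>m. c (m + (n - N) + N)) + (\<Sum>m<n - N. c (m + N))"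
      unfolding S_def by (rule suminf_split_initial_segment[OF summable_ignore_initial_segment[OF tail(1)]])
    also have "(\<Sum>m<n - N. c (m + N)) = (\<Sum>m = N..<n. c m)"
      using sum.shift_bounds_nat_ivl[of c 0 N "n - N"] that by (simp add: atLeast0LessThan)
    also have "(\<Sum>m. c (m + (n - N) + N)) = S n" using that by (simp add: S_def)
    finally have "S N = S n + (\<Sum>m = N..<n. c m)" .
    then show ?thesis by (simp add: f_def hc[OF that] algebra_simps)
  qed
  \<comment> \<open>Since \<open>c (Suc n) * y (Suc n)\<close> is the inverse of
    \<open>a n * y (Suc (Suc n))\<close>, the quotient of \<open>f (Suc n)\<close> and
    \<open>decay n\<close> is minus \<open>S (Suc n) / c (Suc n)\<close> divided by
    \<open>v (Suc n) * (a n * growth (Suc n) * decay n)\<close>. Its limit is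
    \<open>\<kappa>\<close>, and the Jost solution is \<open>f\<close> divided by it.\<close>
  define \<kappa> where "\<kappa> = - (1 / (1 - q) / (V * of_real (sgn binf / (varkappa_inf a * theta_inf))))"
  have q1: "q \<noteq> 1" using q by auto
  have ne: "sgn binf / (varkappa_inf a * theta_inf) \<noteq> 0"
    using sgn_binf varkappa_inf_nz theta_inf(1) by auto
  have \<kappa>: "\<kappa> \<noteq> 0"
    unfolding \<kappa>_def neg_equal_0_iff_equal divide_eq_0_iff using V(2) q1 ne by auto
  have Sc: "(\<lambda>n. S (Suc n) / c (Suc n)) \<longlonglongrightarrow> 1 / (1 - q)"
    using tail(2)[folded S_def] by (rule LIMSEQ_Suc)
  have "(\<lambda>n. - (S (Suc n) / c (Suc n) / (v (Suc n) * of_real (a n * growth (Suc n) * decay n)))) \<longlonglongrightarrow> \<kappa>"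
    unfolding \<kappa>_def using ne V(2)
    by (intro tendsto_minus tendsto_divide[OF Sc] tendsto_mult[OF LIMSEQ_Suc[OF vV]]
        tendsto_of_real growth_decay_lims(1)) auto
  moreover have "eventually (\<lambda>n. - (S (Suc n) / c (Suc n) / (v (Suc n) * of_real (a n * growth (Suc n) * decay n)))
      = f (Suc n) / of_real (decay n)) sequentially"
    using eventually_ge_at_top[of N]
  proof eventually_elim
    case (elim n)
    have "y (Suc n) \<noteq> 0" "y (Suc (Suc n)) \<noteq> 0" "a n \<noteq> 0"
      using elim a_pos[of n] by (auto intro!: ynz)
    then show ?case
      using elim by (simp add: fS c_def v_def field_simps)
  qed
  ultimately have "(\<lambda>n. f (Suc n) / of_real (decay n)) \<longlonglongrightarrow> \<kappa>"
    by (rule Lim_transform_eventually)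
  then have "(\<lambda>n. inverse \<kappa> * (f (Suc n) / of_real (decay n))) \<longlonglongrightarrow> inverse \<kappa> * \<kappa>"
    by (intro tendsto_intros)
  then have "(\<lambda>n. (inverse \<kappa> * f (Suc n)) / of_real (decay n)) \<longlonglongrightarrow> 1" using \<kappa> by simp
  then show ?thesis
    using jacobi_solution_cmult[OF f_jac] by (auto simp: is_jost_solution_iff)
qed

lemma jost_solution: "is_jost_solution a b binf z (jost_solution a b binf z)"
proof -
  obtain f where f: "is_jost_solution a b binf z f" using jost_exists by blast
  then show ?thesis
    unfolding jost_solution_def
    by (rule theI[where P = "is_jost_solution a b binf z"]) (rule jost_unique[OF _ f])
qed

subsection \<open>Asymptotics of the orthogonal polynomials\<close>

definition ortho_factor :: real where
  "ortho_factor = sgn binf / (2 * sqrt (binf\<^sup>2 - 1))"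

lemma ortho_factor_nz: "ortho_factor \<noteq> 0"
proof -
  have "1 < \<bar>binf\<bar>\<^sup>2" using binf by (intro one_less_power) auto
  then show ?thesis using sgn_binf by (auto simp: ortho_factor_def)
qed

lemma growth_ortho_factor:
  "sgn binf ^ (n + 1) / (2 * sqrt (binf\<^sup>2 - 1)) * (exp (phase a b n) / sqrt (a n)) = growth n * ortho_factor"
  by (simp add: growth_def ortho_factor_def mult_ac)

text \<open>With the Jost solution and \<open>U = 1\<close>, \<open>wronskian_growth_decay\<close>
  expresses the Jost function through \<open>V\<close>; here this is solved for
  \<open>V\<close>.\<close>

lemma ortho_poly_limit:
  assumes "(\<lambda>n. ortho_poly a b z (Suc n) / of_real (growth n)) \<longlonglongrightarrow> V"
  shows "V = of_real ortho_factor * (- of_real (varkappa_inf a) * jost_function a b binf z)"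
proof -
  have s: "binf\<^sup>2 - 1 > 0"
    using one_less_power[OF binf, of 2] by simp
  have J: "jost_function a b binf z = - (V * 1 * of_real (2 * sgn binf * sqrt (binf\<^sup>2 - 1) / varkappa_inf a))"
    unfolding jost_function_def using jost_solution[of z] unfolding is_jost_solution_iff
    by (intro wronskian_growth_decay[OF ortho_poly_jacobi_solution[OF a_pos] _ assms]) auto
  have "ortho_factor * varkappa_inf a * (2 * sgn binf * sqrt (binf\<^sup>2 - 1) / varkappa_inf a) = 1"
    using s varkappa_inf_nz sgn_binf by (auto simp: ortho_factor_def)
  then have one: "complex_of_real ortho_factor * of_real (varkappa_inf a)
      * of_real (2 * sgn binf * sqrt (binf\<^sup>2 - 1) / varkappa_inf a) = 1"
    by (simp only: of_real_mult[symmetric] of_real_1)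
  have "of_real ortho_factor * (- of_real (varkappa_inf a) * jost_function a b binf z)
      = V * (complex_of_real ortho_factor * of_real (varkappa_inf a)
          * of_real (2 * sgn binf * sqrt (binf\<^sup>2 - 1) / varkappa_inf a))"
    unfolding J by (simp only: mult_minus_left mult_minus_right minus_minus mult_1_right mult_1_left mult_ac)
  then show ?thesis by (simp only: one mult_1_right)
qed

lemma normalized_ortho_poly_uniform_limit:
  assumes K: "compact K"
  shows "uniform_limit K (\<lambda>n z. ortho_poly a b z (Suc n) / of_real (growth n))
    (\<lambda>z. of_real ortho_factor * (- of_real (varkappa_inf a) * jost_function a b binf z)) sequentially"
proof -
  obtain M where M: "\<And>z. z \<in> K \<Longrightarrow> norm z \<le> M"
    using compact_imp_bounded[OF K] unfolding bounded_iff by blast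
  have bdd: "\<exists>B. \<forall>z\<in>K. norm (ortho_poly a b z n) \<le> B" for n
    using compact_imp_bounded[OF compact_continuous_image[OF continuous_on_ortho_poly K]]
    unfolding bounded_iff by blast
  obtain V where V: "uniform_limit K (\<lambda>n z. ortho_poly a b z (Suc n) / of_real (growth n)) V sequentially"
    using normalized_uniform_limit[of K M "ortho_poly a b", OF M ortho_poly_jacobi_solution[OF a_pos] bdd] by blast
  have "V z = of_real ortho_factor * (- of_real (varkappa_inf a) * jost_function a b binf z)" if "z \<in> K" for z
    by (rule ortho_poly_limit[OF tendsto_uniform_limitI[OF V that]])
  with V show ?thesis by (simp cong: uniform_limit_cong')
qed

text \<open>An additive error keeps the statement uniform across zeros of the Jost function.\<close>

lemma ortho_poly_absolute_asymptotics:
  assumes K: "compact K"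
  shows "\<exists>\<epsilon>. uniform_limit K \<epsilon> (\<lambda>z. 0) sequentially \<and>
    (\<forall>n. \<forall>z\<in>K. ortho_poly a b z (n + 1) =
       of_real (sgn binf ^ (n + 1) / (2 * sqrt (binf\<^sup>2 - 1)) * (exp (phase a b n) / sqrt (a n)))
       * (- of_real (varkappa_inf a) * jost_function a b binf z + \<epsilon> n z))"
proof -
  define V where "V z = of_real ortho_factor * (- of_real (varkappa_inf a) * jost_function a b binf z)" for z
  define \<epsilon> where "\<epsilon> n z = (ortho_poly a b z (Suc n) / of_real (growth n) - V z) * inverse (of_real ortho_factor)" for n z
  have "uniform_limit K (\<lambda>n z. ortho_poly a b z (Suc n) / of_real (growth n) - V z) (\<lambda>z. V z - V z) sequentially"
    unfolding V_def by (intro uniform_limit_minus normalized_ortho_poly_uniform_limit K uniform_limit_const)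
  then have "uniform_limit K \<epsilon> (\<lambda>z. (V z - V z) * inverse (of_real ortho_factor)) sequentially"
    unfolding \<epsilon>_def by (rule bounded_linear.uniform_limit[OF bounded_linear_mult_left])
  moreover have "ortho_poly a b z (n + 1) = of_real (growth n * ortho_factor)
      * (- of_real (varkappa_inf a) * jost_function a b binf z + \<epsilon> n z)" for n z
    using ortho_factor_nz by (simp add: \<epsilon>_def V_def field_simps)
  ultimately show ?thesis unfolding growth_ortho_factor by auto
qed

text \<open>Serves to bound the reciprocal of the Jost function on compact sets that contain none of
  its zeros.\<close>

lemma continuous_on_jost_function:
  assumes K: "compact K"
  shows "continuous_on K (jost_function a b binf)"
proof -
  have "continuous_on K (\<lambda>z. of_real ortho_factor * (- of_real (varkappa_inf a) * jost_function a b binf z))"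
    by (rule uniform_limit_theorem[OF _ normalized_ortho_poly_uniform_limit[OF K]])
       (auto simp: divide_inverse intro!: always_eventually continuous_intros continuous_on_ortho_poly)
  then have "continuous_on K (\<lambda>z. inverse (- of_real (ortho_factor * varkappa_inf a))
      * (of_real ortho_factor * (- of_real (varkappa_inf a) * jost_function a b binf z)))"
    by (rule continuous_on_mult_left)
  then show ?thesis
    using ortho_factor_nz varkappa_inf_nz by (simp add: field_simps)
qed

text \<open>Division by \<open>D\<close>, whose reciprocal is bounded on \<open>K\<close>, turns the
  additive error into a relative one.\<close>

lemma ortho_poly_relative_asymptotics:
  assumes K: "compact K" and nz: "\<forall>z\<in>K. jost_function a b binf z \<noteq> 0"
  shows "\<exists>\<epsilon>. uniform_limit K \<epsilon> (\<lambda>z. 0) sequentially \<and>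
    (\<forall>n. \<forall>z\<in>K. ortho_poly a b z (n + 1) =
       - of_real (varkappa_inf a) * jost_function a b binf z
       * of_real (sgn binf ^ (n + 1) / (2 * sqrt (binf\<^sup>2 - 1)) * (exp (phase a b n) / sqrt (a n)))
       * (1 + \<epsilon> n z))"
proof -
  define D where "D z = - of_real (varkappa_inf a) * jost_function a b binf z" for z
  have Dnz: "D z \<noteq> 0" if "z \<in> K" for z
    using nz that varkappa_inf_nz by (simp add: D_def)
  obtain \<epsilon> where \<epsilon>: "uniform_limit K \<epsilon> (\<lambda>z. 0) sequentially"
    and P: "\<And>n z. z \<in> K \<Longrightarrow> ortho_poly a b z (n + 1) =
       of_real (sgn binf ^ (n + 1) / (2 * sqrt (binf\<^sup>2 - 1)) * (exp (phase a b n) / sqrt (a n))) * (D z + \<epsilon> n z)"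
    using ortho_poly_absolute_asymptotics[OF K] unfolding D_def by blast
  have "continuous_on K (\<lambda>z. inverse (D z))"
    unfolding D_def using Dnz
    by (intro continuous_on_inverse continuous_intros continuous_on_jost_function K) (auto simp: D_def)
  then have "bounded ((\<lambda>z. inverse (D z)) ` K)"
    by (intro compact_imp_bounded compact_continuous_image K)
  then have "uniform_limit K (\<lambda>n z. \<epsilon> n z * inverse (D z)) (\<lambda>z. 0 * inverse (D z)) sequentially"
    by (intro uniform_lim_mult \<epsilon> uniform_limit_const) (auto simp: bounded_iff)
  moreover have "ortho_poly a b z (n + 1) = D z
       * of_real (sgn binf ^ (n + 1) / (2 * sqrt (binf\<^sup>2 - 1)) * (exp (phase a b n) / sqrt (a n)))
       * (1 + \<epsilon> n z * inverse (D z))" if "z \<in> K" for n z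
    proof -
    have "D z + \<epsilon> n z = D z * (1 + \<epsilon> n z * inverse (D z))"
      using Dnz[OF that] by (simp add: field_simps)
    then show ?thesis unfolding P[OF that] by (simp only: mult_ac)
  qed
  ultimately show ?thesis unfolding D_def by auto
qed

section \<open>The second solution and the zeros of the Jost function\<close>

lemma admissible_start_exists: "\<exists>n0. admissible_start a b binf z n0"
proof -
  obtain N where N: "\<And>n. n \<ge> N \<Longrightarrow> jost_solution a b binf z (Suc n) \<noteq> 0"
    using jost_eventually_nonzero[OF jost_solution] unfolding eventually_sequentially by blast
  have "admissible_start a b binf z (Suc N)"
    using N by (simp add: admissible_start_def)
  then show ?thesis by blast
qed

text \<open>Reduction of order along \<open>f\<close> from position \<open>n0\<close> yields a
  solution with Wronskian 1 that meets the description of the second solution; uniqueness identifies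
  the two.\<close>

lemma second_solution_wronskian:
  assumes adm: "admissible_start a b binf z n0"
  shows "wronskian a (jost_solution a b binf z) (second_solution a b binf z n0) = 1"
proof -
  define f where "f = jost_solution a b binf z"
  have f: "jacobi_solution a b z f" using jost_solution by (simp add: f_def is_jost_solution_def)
  \<comment> \<open>Position \<open>n\<close> holds the term of index \<open>n - 1\<close>, so
    admissibility reaches down to position \<open>n0\<close>, where \<open>h\<close> needs a nonzero
    divisor.\<close>
  have nz: "f n \<noteq> 0" if "n \<ge> n0" for n
  proof -
    have "n0 \<ge> 1" "jost_solution a b binf z (n - 1 + 1) \<noteq> 0"
      using adm that unfolding admissible_start_def by (blast intro: diff_le_mono)+
    then show ?thesis using that by (simp add: f_def)
  qed
  obtain h where h: "jacobi_solution a b z h" "h n0 = 0" "h (Suc n0) = inverse (of_real (prev_coeff a n0) * f n0)"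
    using jacobi_solution_exists[of a b z n0] a_pos by metis
  note red = reduction_of_order[OF a_pos f h nz]
  let ?P = "\<lambda>G. jacobi_solution a b z G \<and> (\<forall>n \<ge> n0. G (n + 1) =
           f (n + 1) * (\<Sum>m = n0..n. inverse (of_real (prev_coeff a m) * f m * f (m + 1))))"
  have Ph: "?P h"
    using h(1) red(2) by (auto simp: atLeastLessThanSuc_atLeastAtMost)
  \<comment> \<open>The description prescribes values from position \<open>Suc n0\<close> on, so the
    comparison starts there and not at \<open>n0\<close>.\<close>
  have "G = h" if "?P G" for G
    by (rule jacobi_solution_unique[of a b z, where n = "Suc n0"]) (use a_pos that Ph in simp_all)
  then have "second_solution a b binf z n0 = h"
    unfolding second_solution_def Let_def f_def[symmetric] using Ph by (intro the_equality)
  then show ?thesis using red(1) by (simp add: f_def)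
qed

text \<open>If the Jost function vanishes, the polynomials are \<open>c\<close> times the Jost
  solution. Then \<open>W = c\<close>, as the Jost solution and the second solution have Wronskian
  1, and \<open>c\<close> is nonzero because the polynomial of degree 0 is 1. The factor in front of
  the polynomials is \<open>1 / decay n\<close>.\<close>

lemma ortho_poly_subdominant:
  assumes zero: "jost_function a b binf z = 0" and adm: "admissible_start a b binf z n0"
  defines "W \<equiv> wronskian a (ortho_poly a b z) (second_solution a b binf z n0)"
  shows "(\<lambda>n. of_real (sqrt (a n) * exp (phase a b n) * sgn binf ^ n) * ortho_poly a b z (n + 1)) \<longlonglongrightarrow> W"
    and "W \<noteq> 0"
proof -
  define f where "f = jost_solution a b binf z"
  have f: "jacobi_solution a b z f" "(\<lambda>n. f (Suc n) / of_real (decay n)) \<longlonglongrightarrow> 1"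
    using jost_solution[of z] by (simp_all add: f_def is_jost_solution_iff)
  have "f (Suc (n0 - 1)) \<noteq> 0"
    using adm by (auto simp: admissible_start_def f_def)
  then obtain c where c: "ortho_poly a b z = (\<lambda>n. c * f n)"
    using wronskian_zero_imp_multiple[OF ortho_poly_jacobi_solution[OF a_pos] f(1)] zero
    unfolding jost_function_def f_def by blast
  have Wc: "W = c"
    unfolding W_def c wronskian_cmult_left f_def second_solution_wronskian[OF adm] by simp
  have "c * f 1 = 1" using fun_cong[OF c, of 1] by simp
  then show "W \<noteq> 0" unfolding Wc by auto
  have "(\<lambda>n. c * (f (Suc n) / of_real (decay n))) \<longlonglongrightarrow> c * 1"
    by (intro tendsto_intros f)
  moreover have "c * (f (Suc n) / of_real (decay n))
      = of_real (sqrt (a n) * exp (phase a b n) * sgn binf ^ n) * ortho_poly a b z (n + 1)" for n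
  proof -
    have "sqrt (a n) * exp (phase a b n) * sgn binf ^ n * decay n = (sgn binf * sgn binf) ^ n"
      using a_pos[of n] unfolding power_mult_distrib by (simp add: decay_def exp_minus)
    then have "of_real (sqrt (a n) * exp (phase a b n) * sgn binf ^ n) * of_real (decay n) = (1 :: complex)"
      by (simp only: of_real_mult[symmetric] sgn_binf_sq power_one of_real_1)
    then have "of_real (sqrt (a n) * exp (phase a b n) * sgn binf ^ n) = 1 / complex_of_real (decay n)"
      by (simp only: eq_divide_eq of_real_eq_0_iff decay_nz simp_thms if_True if_False)
    then show ?thesis by (simp only: c Suc_eq_plus1) simp
  qed
  ultimately show "(\<lambda>n. of_real (sqrt (a n) * exp (phase a b n) * sgn binf ^ n) * ortho_poly a b z (n + 1)) \<longlonglongrightarrow> W"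
    by (simp only: Wc mult_1_right)
qed

end

text \<open>At a zero of the Jost function a purely relative error would force the polynomials to
  vanish. Uniformity is therefore stated with an additive error on all compact sets and with a
  relative one on those free of zeros. Existence of an admissible start keeps the last part from
  being vacuous.\<close>

theorem theorem4p17:
  fixes a b :: "nat \<Rightarrow> real" and binf :: real
  assumes "\<And>n. a n > 0"
    and "summable (\<lambda>n. inverse (a n))"
    and "beta a b \<longlonglongrightarrow> binf" and "\<bar>binf\<bar> > 1"
    and "summable (\<lambda>n. \<bar>kcoeff a n - 1\<bar>)"
    and "summable (\<lambda>n. \<bar>beta a b (n + 1) - beta a b n\<bar>)"
  shows "(\<forall>K. compact K \<longrightarrow>
            (\<exists>\<epsilon>. uniform_limit K \<epsilon> (\<lambda>z. 0) sequentially \<and>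
              (\<forall>n. \<forall>z \<in> K. ortho_poly a b z (n + 1) =
                 of_real (sgn binf ^ (n + 1) / (2 * sqrt (binf\<^sup>2 - 1)) * (exp (phase a b n) / sqrt (a n)))
                 * (- of_real (varkappa_inf a) * jost_function a b binf z + \<epsilon> n z))))
       \<and> (\<forall>K. compact K \<and> (\<forall>z \<in> K. jost_function a b binf z \<noteq> 0) \<longrightarrow>
            (\<exists>\<epsilon>. uniform_limit K \<epsilon> (\<lambda>z. 0) sequentially \<and>
              (\<forall>n. \<forall>z \<in> K. ortho_poly a b z (n + 1) =
                 - of_real (varkappa_inf a) * jost_function a b binf z
                 * of_real (sgn binf ^ (n + 1) / (2 * sqrt (binf\<^sup>2 - 1)) * (exp (phase a b n) / sqrt (a n)))
                 * (1 + \<epsilon> n z))))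
       \<and> (\<forall>z. jost_function a b binf z = 0 \<longrightarrow>
            (\<exists>n0. admissible_start a b binf z n0) \<and>
            (\<forall>n0. admissible_start a b binf z n0 \<longrightarrow>
              (\<lambda>n. of_real (sqrt (a n) * exp (phase a b n) * sgn binf ^ n) * ortho_poly a b z (n + 1))
                \<longlonglongrightarrow> wronskian a (ortho_poly a b z) (second_solution a b binf z n0)
              \<and> wronskian a (ortho_poly a b z) (second_solution a b binf z n0) \<noteq> 0))"
proof -
  interpret jacobi_coeffs a b binf by unfold_locales (rule assms)+
  show ?thesis
    by (intro conjI allI impI ortho_poly_absolute_asymptotics ortho_poly_relative_asymptotics
        admissible_start_exists ortho_poly_subdominant) blast+
qed

end
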